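(* Let $\mathbf w\in[0,1]^m$ and let $Q,R,\widehat Q,\widehat R$ be the factors of the thin QR decompositions $$QR = M^{-1/2}F^T\Gamma^{-1/2}\in\mathbb R^{n\times m},\qquad \widehat Q\widehat R = M^{-1/2}CM^{-1}\left[Q^T\ast Q\right]^T\in\mathbb R^{n\times \ell^2},$$ with $Q\in\mathbb R^{n\times\ell}$, $R\in\mathbb R^{\ell\times m}$, $Q^TQ=I_\ell$, $\widehat Q\in\mathbb R^{n\times\hat\ell}$, $\widehat R\in\mathbb R^{\hat\ell\times\ell^2}$, $\widehat Q^T\widehat Q=I_{\hat\ell}$. Put $L_{\mathbf w}:=R\,\mathrm{Diag}(\mathbf w)R^T\in\mathbb R^{\ell\times\ell}$ and $\widehat L_{\mathbf w}:=\widehat R\,[L_{\mathbf w}\otimes L_{\mathbf w}]\,\widehat R^T\in\mathbb R^{\hat\ell\times\hat\ell}$. Then the matrix representation of the posterior covariance operator $\mathcal C_{\mathrm{post}}(\mathbf w):V_h^0\to V_h^0$ can be written as $$C_{\mathrm{post}}(\mathbf w) = M^{-1}CM^{-1/2}\Big(I-\widehat Q\widehat Q^T+\widehat Q\big(\widehat L_{\mathbf w}+I_{\hat\ell}\big)^{-1}\widehat Q^T\Big)M^{-1/2}C .$$ Moreover, for covariance matrix data $G\in\mathbb R^{m\times m}$ (modelled as $G\sim\mathcal N(\mathcal F\,\mathrm{Diag}(q)\mathcal F^*,\Gamma\otimes\Gamma)$), the coefficient vector of the posterior mean $q_{\mathrm{post}}(\mathbf w)\in V_h^0$ is $$\mathbf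 q_{\mathrm{post}}(\mathbf w)=C_{\mathrm{post}}(\mathbf w)\Big(M^{-1}\mathrm{diag}\big(QR\,\Gamma^{-1/2}\mathrm{Diag}(\mathbf w)\,G\,\mathrm{Diag}(\mathbf w)\,\Gamma^{-1/2}R^TQ^T\big)+C^{-1}MC^{-1}M\mathbf q_0\Big),$$ where $\mathbf q_0$ is the coefficient vector of the prior mean $q_0\in V_h^0$.
   Context: Discretization. $\Omega\subset\mathbb R^d$ is partitioned (triangulated) into elements $\Omega_1,\dots,\Omega_n$ of positive measure; $V_h^0\subset L^2(\Omega)$ is the span of the indicator functions $\varphi_i=\mathbf 1_{\Omega_i}$, with the $L^2$ inner product. A function $g_h=\sum_i g_i\varphi_i$ has coefficient vector $(g_1,\dots,g_n)^T$. $M=\mathrm{Diag}(m_1,\dots,m_n)$, $m_i=|\Omega_i|$, is the mass matrix. A linear operator $\mathcal A:V_h^0\to V_h^0$ has matrix representation $M^{-1}A$, where $A_{ij}=(\mathcal A\varphi_j,\varphi_i)_{L^2}$; this means that $\mathcal A g_h$ has coefficient vector $M^{-1}A\boldsymbol g$ whenever $g_h$ has coefficient vector $\boldsymbol g$. For such $\mathcal A$ (with kernel $k=\sum_{i,j} m_i^{-1}A_{ij}m_j^{-1}\varphi_i(x)\varphi_j(y)$, so $\mathcal A f(x)=\int_\Omega k(x,y)f(y)\,dy$), $\mathrm{diag}(\mathcal A)\in V_h^0$ is the function $x\mapsto k(x,x)$. For $q_h\in V_h^0$, $\mathrm{Diag}(q_h):V_h^0\to V_h^0$ is multiplication by $q_h$.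 For matrices and vectors, $\mathrm{diag}$ extracts the diagonal of a matrix as a vector, and $\mathrm{Diag}$ forms a diagonal matrix from a vector. Model. $\mathcal F:V_h^0\to\mathbb R^m$ is linear with matrix $F\in\mathbb R^{m\times n}$, $F_{ij}=(\mathcal F\varphi_j)_i$; its $L^2$-adjoint $\mathcal F^*:\mathbb R^m\to V_h^0$ has matrix $M^{-1}F^T$. $\Gamma\in\mathbb R^{m\times m}$ is a diagonal positive definite noise covariance. The prior is $q\sim\mathcal N(q_0,\mathcal C_0)$ on $V_h^0$ with $\mathcal C_0$ self-adjoint positive definite; $\mathcal C_0^{1/2}$ has matrix representation $M^{-1}C$ (so $C$ is symmetric and invertible). For a design $\mathbf w$, $\mathcal F_{\mathbf w}=\mathrm{Diag}(\mathbf w)\mathcal F$ and $\Gamma_{\mathbf w}^\dagger=\Gamma^{-1/2}\mathrm{Diag}(\mathbf w)\Gamma^{-1/2}$. The posterior covariance and mean are $$\mathcal C_{\mathrm{post}}(\mathbf w)=\big(\mathcal H_{\mathbf w}+\mathcal C_0^{-1}\big)^{-1},\quad \mathcal H_{\mathbf w}q=\mathrm{diag}\big(\mathcal F^*\Gamma_{\mathbf w}^\dagger\mathcal F\,\mathrm{Diag}(q)\,\mathcal F^*\Gamma_{\mathbf w}^\dagger\mathcal F\big),$$ $$q_{\mathrm{post}}(\mathbf w)=\mathcal C_{\mathrm{post}}(\mathbf w)\big(\mathrm{diag}(\mathcal F_{\mathbf w}^*\Gamma^{-1}G\Gamma^{-1}\mathcal F_{\mathbf w})+\mathcal C_0^{-1}q_0\big).$$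 Matrix products. $\mathrm{vec}$ stacks the columns of a matrix, $\mathrm{mat}$ is its inverse on vectors of square length (producing square matrices). The Kronecker product convention is $(A\otimes B)\mathbf x=\mathrm{vec}(A\,\mathrm{mat}(\mathbf x)B^T)$. $Q^T\ast Q\in\mathbb R^{\ell^2\times n}$ is the column-wise Khatri–Rao product with entries $(Q^T\ast Q)_{i+(k-1)\ell,\,j}=Q_{jk}Q_{ji}$ for $1\le i,k\le\ell$, $1\le j\le n$. *)

theory Defs
  imports
    "HOL-Analysis.Lebesgue_Measure"
    "HOL-Analysis.Set_Integral"
    "Jordan_Normal_Form.Matrix"
    "Jordan_Normal_Form.Gauss_Jordan_Elimination"
begin

(* Matrices are those of Jordan_Normal_Form, so every dimension, l and lh included,
   is a natural number (possibly 0), and indices start at 0. *)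

no_notation inner (infix "\<bullet>" 70)

definition Diag :: "real vec \<Rightarrow> real mat" where
  "Diag v = mat_diag (dim_vec v) (\<lambda>i. v $ i)"

definition diag :: "real mat \<Rightarrow> real vec" where
  "diag A = vec (dim_row A) (\<lambda>i. A $$ (i, i))"

(* Unspecified if A is singular. *)
definition minv :: "real mat \<Rightarrow> real mat" where
  "minv A = the (mat_inverse A)"

(* The power -1/2 of a diagonal matrix with positive diagonal. *)
definition inv_sqrt_diag :: "real mat \<Rightarrow> real mat" where
  "inv_sqrt_diag A = Diag (map_vec (\<lambda>x. 1 / sqrt x) (diag A))"

definition pos_def_mat :: "nat \<Rightarrow> real mat \<Rightarrow> bool" where
  "pos_def_mat k A \<longleftrightarrow> A \<in> carrier_mat k k \<and> transpose_mat A = A \<and>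
     (\<forall>v \<in> carrier_vec k. v \<noteq> 0\<^sub>v k \<longrightarrow> v \<bullet> (A *\<^sub>v v) > 0)"

(* Column stacking: entry (i, k) of an l-row matrix is entry i + k * l of the vector. *)
definition vec_of_mat :: "real mat \<Rightarrow> real vec" where
  "vec_of_mat A = vec (dim_row A * dim_col A) (\<lambda>r. A $$ (r mod dim_row A, r div dim_row A))"

definition mat_of_vec :: "nat \<Rightarrow> real vec \<Rightarrow> real mat" where
  "mat_of_vec l x = mat l l (\<lambda>(i, k). x $ (i + k * l))"

(* Convention (A \<otimes> B) vec(X) = vec(A X B^T), see kronecker_mult_vec: the left factor
   acts on the fast index. The textbook convention with column stacking is the opposite. *)
definition kronecker :: "real mat \<Rightarrow> real mat \<Rightarrow> real mat" where
  "kronecker A B = mat (dim_row A * dim_row B) (dim_col A * dim_col B)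
     (\<lambda>(r, s). A $$ (r mod dim_row A, s mod dim_col A) * B $$ (r div dim_row A, s div dim_col A))"

(* Column j is the Kronecker product, in the same convention, of the columns j of A and B. *)
definition khatri_rao :: "real mat \<Rightarrow> real mat \<Rightarrow> real mat" where
  "khatri_rao A B = mat (dim_row A * dim_row B) (dim_col A)
     (\<lambda>(r, j). A $$ (r mod dim_row A, j) * B $$ (r div dim_row A, j))"

lemma khatri_rao_entry:
  assumes "Q \<in> carrier_mat n l" "i < l" "k < l" "j < n"
  shows "khatri_rao (transpose_mat Q) (transpose_mat Q) $$ (i + k * l, j) = Q $$ (j, k) * Q $$ (j, i)"
proof -
  have "i + k * l < l * l"
  proof -
    have "i + k * l < Suc k * l" using assms by simp
    also have "\<dots> \<le> l * l" using assms by (intro mult_right_mono) auto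
    finally show ?thesis .
  qed
  then show ?thesis using assms by (auto simp: khatri_rao_def)
qed

lemma kronecker_mult_vec:
  assumes A: "A \<in> carrier_mat l l" and B: "B \<in> carrier_mat l l" and x: "x \<in> carrier_vec (l * l)"
  shows "kronecker A B *\<^sub>v x = vec_of_mat (A * mat_of_vec l x * transpose_mat B)"
proof (rule eq_vecI)
  have d: "dim_row A = l" "dim_col A = l" "dim_row B = l" "dim_col B = l" using A B by auto
  show "dim_vec (kronecker A B *\<^sub>v x) = dim_vec (vec_of_mat (A * mat_of_vec l x * transpose_mat B))"
    by (simp add: kronecker_def vec_of_mat_def d)
  fix r assume "r < dim_vec (vec_of_mat (A * mat_of_vec l x * transpose_mat B))"
  then have r: "r < l * l" by (simp add: vec_of_mat_def d)
  then have l: "l > 0" by (cases l) auto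
  have rm: "r mod l < l" "r div l < l" using r l by (auto simp: less_mult_imp_div_less)
  have "(kronecker A B *\<^sub>v x) $ r =
      (\<Sum>s<l * l. A $$ (r mod l, s mod l) * B $$ (r div l, s div l) * x $ s)"
    using r x by (simp add: kronecker_def d scalar_prod_def lessThan_atLeast0)
  also have "\<dots> = (\<Sum>k<l. \<Sum>i<l. A $$ (r mod l, i) * B $$ (r div l, k) * x $ (i + k * l))"
  proof -
    have "sum h {..<l * l} = (\<Sum>k<l. \<Sum>i<l. h (i + k * l))" for h :: "nat \<Rightarrow> real"
    proof -
      have "sum h {k * l..<k * l + l} = (\<Sum>i<l. h (i + k * l))" for k
        using sum.shift_bounds_nat_ivl[of h 0 "k * l" l] by (simp add: add.commute lessThan_atLeast0)
      then show ?thesis by (simp flip: sum.nat_group)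
    qed
    then show ?thesis by simp
  qed
  also have "\<dots> = vec_of_mat (A * mat_of_vec l x * transpose_mat B) $ r"
    using r rm by (simp add: vec_of_mat_def mat_of_vec_def d scalar_prod_def lessThan_atLeast0
        sum_distrib_right sum_distrib_left mult_ac)
  finally show "(kronecker A B *\<^sub>v x) $ r = vec_of_mat (A * mat_of_vec l x * transpose_mat B) $ r" .
qed

(* Thin in that Q has only l orthonormal columns; R is upper triangular (trapezoidal). *)
definition thin_QR :: "nat \<Rightarrow> real mat \<Rightarrow> real mat \<Rightarrow> real mat \<Rightarrow> bool" where
  "thin_QR l A Q R \<longleftrightarrow> Q \<in> carrier_mat (dim_row A) l \<and> R \<in> carrier_mat l (dim_col A) \<and>
     Q * R = A \<and> transpose_mat Q * Q = 1\<^sub>m l \<and>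
     (\<forall>i < l. \<forall>j < dim_col A. j < i \<longrightarrow> R $$ (i, j) = 0)"

definition is_mesh :: "'d::euclidean_space set \<Rightarrow> nat \<Rightarrow> (nat \<Rightarrow> 'd set) \<Rightarrow> bool" where
  "is_mesh Omega n E \<longleftrightarrow> Omega = (\<Union>i<n. E i) \<and> disjoint_family_on E {..<n} \<and>
     (\<forall>i<n. E i \<in> lmeasurable \<and> measure lebesgue (E i) > 0)"

definition phi :: "(nat \<Rightarrow> 'd set) \<Rightarrow> nat \<Rightarrow> 'd \<Rightarrow> real" where
  "phi E i = indicator (E i)"

definition fe_fun :: "nat \<Rightarrow> (nat \<Rightarrow> 'd set) \<Rightarrow> real vec \<Rightarrow> 'd \<Rightarrow> real" where
  "fe_fun n E g = (\<lambda>x. \<Sum>i<n. g $ i * phi E i x)"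

definition has_coeffs :: "nat \<Rightarrow> (nat \<Rightarrow> 'd set) \<Rightarrow> ('d \<Rightarrow> real) \<Rightarrow> real vec \<Rightarrow> bool" where
  "has_coeffs n E f g \<longleftrightarrow> g \<in> carrier_vec n \<and> f = fe_fun n E g"

(* Functions on Omega are extended by 0 to the whole space. *)
definition Vh :: "nat \<Rightarrow> (nat \<Rightarrow> 'd set) \<Rightarrow> ('d \<Rightarrow> real) set" where
  "Vh n E = fe_fun n E ` carrier_vec n"

definition L2_inner :: "'d::euclidean_space set \<Rightarrow> ('d \<Rightarrow> real) \<Rightarrow> ('d \<Rightarrow> real) \<Rightarrow> real" where
  "L2_inner Omega f g = (LINT x:Omega|lebesgue. f x * g x)"

definition mass_mat :: "nat \<Rightarrow> (nat \<Rightarrow> 'd::euclidean_space set) \<Rightarrow> real mat" where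
  "mass_mat n E = Diag (vec n (\<lambda>i. measure lebesgue (E i)))"

(* Operators on Vh are functions on all of 'd => real; only their values on Vh matter. *)

definition linear_Vh :: "nat \<Rightarrow> (nat \<Rightarrow> 'd set) \<Rightarrow> (('d \<Rightarrow> real) \<Rightarrow> ('d \<Rightarrow> real)) \<Rightarrow> bool" where
  "linear_Vh n E A \<longleftrightarrow> (\<forall>f \<in> Vh n E. A f \<in> Vh n E) \<and>
     (\<forall>f \<in> Vh n E. \<forall>g \<in> Vh n E. A (\<lambda>x. f x + g x) = (\<lambda>x. A f x + A g x)) \<and>
     (\<forall>c. \<forall>f \<in> Vh n E. A (\<lambda>x. c * f x) = (\<lambda>x. c * A f x))"

definition linear_Vh_vec ::
    "nat \<Rightarrow> (nat \<Rightarrow> 'd set) \<Rightarrow> nat \<Rightarrow> (('d \<Rightarrow> real) \<Rightarrow> real vec) \<Rightarrow> bool" where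
  "linear_Vh_vec n E m A \<longleftrightarrow> (\<forall>f \<in> Vh n E. A f \<in> carrier_vec m) \<and>
     (\<forall>f \<in> Vh n E. \<forall>g \<in> Vh n E. A (\<lambda>x. f x + g x) = A f + A g) \<and>
     (\<forall>c. \<forall>f \<in> Vh n E. A (\<lambda>x. c * f x) = c \<cdot>\<^sub>v A f)"

definition self_adjoint ::
    "'d::euclidean_space set \<Rightarrow> nat \<Rightarrow> (nat \<Rightarrow> 'd set) \<Rightarrow> (('d \<Rightarrow> real) \<Rightarrow> ('d \<Rightarrow> real)) \<Rightarrow> bool" where
  "self_adjoint Omega n E A \<longleftrightarrow> linear_Vh n E A \<and>
     (\<forall>f \<in> Vh n E. \<forall>g \<in> Vh n E. L2_inner Omega (A f) g = L2_inner Omega f (A g))"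

definition pos_def_op ::
    "'d::euclidean_space set \<Rightarrow> nat \<Rightarrow> (nat \<Rightarrow> 'd set) \<Rightarrow> (('d \<Rightarrow> real) \<Rightarrow> ('d \<Rightarrow> real)) \<Rightarrow> bool" where
  "pos_def_op Omega n E A \<longleftrightarrow> (\<forall>f \<in> Vh n E. f \<noteq> (\<lambda>x. 0) \<longrightarrow> L2_inner Omega (A f) f > 0)"

(* S is the self-adjoint positive square root of A; it is unique as an operator on Vh. *)
definition is_sqrt_op ::
    "'d::euclidean_space set \<Rightarrow> nat \<Rightarrow> (nat \<Rightarrow> 'd set) \<Rightarrow> (('d \<Rightarrow> real) \<Rightarrow> ('d \<Rightarrow> real)) \<Rightarrow>
     (('d \<Rightarrow> real) \<Rightarrow> ('d \<Rightarrow> real)) \<Rightarrow> bool" where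
  "is_sqrt_op Omega n E A S \<longleftrightarrow> self_adjoint Omega n E S \<and>
     (\<forall>f \<in> Vh n E. L2_inner Omega (S f) f \<ge> 0) \<and> (\<forall>f \<in> Vh n E. S (S f) = A f)"

definition inv_op ::
    "nat \<Rightarrow> (nat \<Rightarrow> 'd set) \<Rightarrow> (('d \<Rightarrow> real) \<Rightarrow> ('d \<Rightarrow> real)) \<Rightarrow> ('d \<Rightarrow> real) \<Rightarrow> ('d \<Rightarrow> real)" where
  "inv_op n E A = inv_into (Vh n E) A"

definition gram ::
    "'d::euclidean_space set \<Rightarrow> nat \<Rightarrow> (nat \<Rightarrow> 'd set) \<Rightarrow> (('d \<Rightarrow> real) \<Rightarrow> ('d \<Rightarrow> real)) \<Rightarrow> real mat" where
  "gram Omega n E A = mat n n (\<lambda>(i, j). L2_inner Omega (A (phi E j)) (phi E i))"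

definition has_matrix_rep ::
    "'d::euclidean_space set \<Rightarrow> nat \<Rightarrow> (nat \<Rightarrow> 'd set) \<Rightarrow> (('d \<Rightarrow> real) \<Rightarrow> ('d \<Rightarrow> real)) \<Rightarrow>
     real mat \<Rightarrow> bool" where
  "has_matrix_rep Omega n E A X \<longleftrightarrow> X = minv (mass_mat n E) * gram Omega n E A \<and>
     (\<forall>f g. has_coeffs n E f g \<longrightarrow> has_coeffs n E (A f) (X *\<^sub>v g))"

definition kernel ::
    "'d::euclidean_space set \<Rightarrow> nat \<Rightarrow> (nat \<Rightarrow> 'd set) \<Rightarrow> (('d \<Rightarrow> real) \<Rightarrow> ('d \<Rightarrow> real)) \<Rightarrow>
     'd \<Rightarrow> 'd \<Rightarrow> real" where
  "kernel Omega n E A x y = (\<Sum>i<n. \<Sum>j<n. inverse (measure lebesgue (E i)) *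
     gram Omega n E A $$ (i, j) * inverse (measure lebesgue (E j)) * phi E i x * phi E j y)"

definition diag_op ::
    "'d::euclidean_space set \<Rightarrow> nat \<Rightarrow> (nat \<Rightarrow> 'd set) \<Rightarrow> (('d \<Rightarrow> real) \<Rightarrow> ('d \<Rightarrow> real)) \<Rightarrow>
     'd \<Rightarrow> real" where
  "diag_op Omega n E A = (\<lambda>x. kernel Omega n E A x x)"

definition Diag_op :: "('d \<Rightarrow> real) \<Rightarrow> ('d \<Rightarrow> real) \<Rightarrow> ('d \<Rightarrow> real)" where
  "Diag_op q = (\<lambda>f x. q x * f x)"

definition matrix_of_fwd ::
    "nat \<Rightarrow> (nat \<Rightarrow> 'd set) \<Rightarrow> nat \<Rightarrow> (('d \<Rightarrow> real) \<Rightarrow> real vec) \<Rightarrow> real mat" where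
  "matrix_of_fwd n E m A = mat m n (\<lambda>(i, j). A (phi E j) $ i)"

definition L2_adjoint ::
    "'d::euclidean_space set \<Rightarrow> nat \<Rightarrow> (nat \<Rightarrow> 'd set) \<Rightarrow> (('d \<Rightarrow> real) \<Rightarrow> real vec) \<Rightarrow>
     real vec \<Rightarrow> ('d \<Rightarrow> real)" where
  "L2_adjoint Omega n E A y =
     (THE g. g \<in> Vh n E \<and> (\<forall>f \<in> Vh n E. L2_inner Omega f g = A f \<bullet> y))"

definition weighted_fwd :: "real vec \<Rightarrow> (('d \<Rightarrow> real) \<Rightarrow> real vec) \<Rightarrow> ('d \<Rightarrow> real) \<Rightarrow> real vec" where
  "weighted_fwd w Fop = (\<lambda>f. Diag w *\<^sub>v Fop f)"

definition weighted_noise_pinv :: "real mat \<Rightarrow> real vec \<Rightarrow> real mat" where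
  "weighted_noise_pinv \<Gamma> w = inv_sqrt_diag \<Gamma> * Diag w * inv_sqrt_diag \<Gamma>"

definition misfit_op ::
    "'d::euclidean_space set \<Rightarrow> nat \<Rightarrow> (nat \<Rightarrow> 'd set) \<Rightarrow> (('d \<Rightarrow> real) \<Rightarrow> real vec) \<Rightarrow>
     real mat \<Rightarrow> real vec \<Rightarrow> ('d \<Rightarrow> real) \<Rightarrow> ('d \<Rightarrow> real)" where
  "misfit_op Omega n E Fop \<Gamma> w =
     (\<lambda>f. L2_adjoint Omega n E Fop (weighted_noise_pinv \<Gamma> w *\<^sub>v Fop f))"

definition hessian_op ::
    "'d::euclidean_space set \<Rightarrow> nat \<Rightarrow> (nat \<Rightarrow> 'd set) \<Rightarrow> (('d \<Rightarrow> real) \<Rightarrow> real vec) \<Rightarrow>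
     real mat \<Rightarrow> real vec \<Rightarrow> ('d \<Rightarrow> real) \<Rightarrow> ('d \<Rightarrow> real)" where
  "hessian_op Omega n E Fop \<Gamma> w = (\<lambda>q. diag_op Omega n E
     (misfit_op Omega n E Fop \<Gamma> w \<circ> Diag_op q \<circ> misfit_op Omega n E Fop \<Gamma> w))"

definition post_precision ::
    "'d::euclidean_space set \<Rightarrow> nat \<Rightarrow> (nat \<Rightarrow> 'd set) \<Rightarrow> (('d \<Rightarrow> real) \<Rightarrow> real vec) \<Rightarrow>
     real mat \<Rightarrow> (('d \<Rightarrow> real) \<Rightarrow> ('d \<Rightarrow> real)) \<Rightarrow> real vec \<Rightarrow> ('d \<Rightarrow> real) \<Rightarrow> ('d \<Rightarrow> real)" where
  "post_precision Omega n E Fop \<Gamma> C0 w =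
     (\<lambda>q x. hessian_op Omega n E Fop \<Gamma> w q x + inv_op n E C0 q x)"

definition post_cov ::
    "'d::euclidean_space set \<Rightarrow> nat \<Rightarrow> (nat \<Rightarrow> 'd set) \<Rightarrow> (('d \<Rightarrow> real) \<Rightarrow> real vec) \<Rightarrow>
     real mat \<Rightarrow> (('d \<Rightarrow> real) \<Rightarrow> ('d \<Rightarrow> real)) \<Rightarrow> real vec \<Rightarrow> ('d \<Rightarrow> real) \<Rightarrow> ('d \<Rightarrow> real)" where
  "post_cov Omega n E Fop \<Gamma> C0 w = inv_op n E (post_precision Omega n E Fop \<Gamma> C0 w)"

definition post_mean ::
    "'d::euclidean_space set \<Rightarrow> nat \<Rightarrow> (nat \<Rightarrow> 'd set) \<Rightarrow> (('d \<Rightarrow> real) \<Rightarrow> real vec) \<Rightarrow>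
     real mat \<Rightarrow> (('d \<Rightarrow> real) \<Rightarrow> ('d \<Rightarrow> real)) \<Rightarrow> ('d \<Rightarrow> real) \<Rightarrow> real mat \<Rightarrow> real vec \<Rightarrow>
     'd \<Rightarrow> real" where
  "post_mean Omega n E Fop \<Gamma> C0 q0 G w = post_cov Omega n E Fop \<Gamma> C0 w
     (\<lambda>x. diag_op Omega n E
            (\<lambda>f. L2_adjoint Omega n E (weighted_fwd w Fop)
               ((minv \<Gamma> * G * minv \<Gamma>) *\<^sub>v weighted_fwd w Fop f)) x
          + inv_op n E C0 q0 x)"

end

theory Submission
  imports Defs "Jordan_Normal_Form.Determinant"
begin

text \<open>
  In coefficients with respect to the indicator functions every operator is a matrix, and the
  theorem becomes a matrix identity. Write \<open>M\<close> for the mass matrix, \<open>D\<close> for its power \<open>-1/2\<close>,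
  \<open>P = Q Lw Q\<^sup>T\<close> and \<open>K\<close> for the Khatri-Rao product of \<open>Q\<^sup>T\<close> with itself.

  By the first QR decomposition the misfit operator has the matrix \<open>S = D P D\<^sup>-\<^sup>1\<close>. The function
  \<open>diag(S Diag(q) S)\<close> has coefficients \<open>\<Sum>\<^sub>j S\<^sub>i\<^sub>j S\<^sub>j\<^sub>i q\<^sub>j / m\<^sub>i\<close>
  (\<open>diag_op_of_sandwich_represented\<close>), and since \<open>P\<close> is symmetric and \<open>D\<close> diagonal,
  \<open>S\<^sub>i\<^sub>j S\<^sub>j\<^sub>i = P\<^sub>i\<^sub>j\<^sup>2\<close>. These squares are the entries of \<open>K\<^sup>T (Lw \<otimes> Lw) K\<close>
  (\<open>congruence_kronecker_square_index\<close>), so the Hessian has the matrix \<open>M\<^sup>-\<^sup>1 K\<^sup>T (Lw \<otimes> Lw) K\<close>.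

  The prior precision has the matrix \<open>C\<^sup>-\<^sup>1 M C\<^sup>-\<^sup>1 M\<close> (\<open>prior_precision_represented\<close>). Factoring
  its root out of the posterior precision on both sides and inserting the second QR
  decomposition leaves \<open>1 + Qh Lhw Qh\<^sup>T\<close>. As \<open>Qh\<close> has orthonormal columns, this is inverted on the
  range of \<open>Qh\<close> and on its complement separately (\<open>inverse_one_plus_orthonormal_update\<close>), which
  gives the covariance formula (\<open>posterior_precision_times_covariance\<close>). The inverse of
  \<open>Lhw + 1\<close> exists because nonnegative weights make \<open>Lw \<otimes> Lw\<close>, and with it \<open>Lhw\<close>, a Gram matrix
  (\<open>gram_factor_of_weighted_kronecker\<close>, \<open>det_gram_plus_one\<close>).

  The data term of the mean is the diagonal of an operator of the same form as the misfit operator;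
  its matrix is conjugate by \<open>D\<close> to the matrix whose diagonal appears in the theorem.
\<close>

section \<open>Products and inverses of matrices\<close>

text \<open>
  The associative and distributive laws with carriers have dimensions that occur only in their
  premises, which the simplifier has to guess for compound factors. In terms of the dimension
  functions all premises are equations that simplification decides.
\<close>
lemma mult_assoc_dim:
  fixes A B C :: "'a::semiring_0 mat"
  assumes "dim_col A = dim_row B" "dim_col B = dim_row C"
  shows "A * B * C = A * (B * C)"
  using assms by (intro assoc_mult_mat[of A _ _ B _ C]) auto

lemma mult_assoc_vec_dim:
  fixes A B :: "'a::semiring_0 mat"
  assumes "dim_col A = dim_row B" "dim_col B = dim_vec v"
  shows "A * B *\<^sub>v v = A *\<^sub>v (B *\<^sub>v v)"
  using assms by (intro assoc_mult_mat_vec[of A _ _ B]) auto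

lemma mult_add_distrib_dim:
  fixes A B C :: "'a::semiring_0 mat"
  assumes "dim_col A = dim_row B" "dim_row C = dim_row B" "dim_col C = dim_col B"
  shows "A * (B + C) = A * B + A * C"
  using assms by (intro mult_add_distrib_mat[of A _ _ B]) auto

lemma transpose_mult_dim:
  fixes A B :: "'a::comm_semiring_0 mat"
  assumes "dim_col A = dim_row B"
  shows "transpose_mat (A * B) = transpose_mat B * transpose_mat A"
  using assms by (intro transpose_mult[of A _ _ B]) auto

lemma mult_left_cancel:
  fixes A B X :: "'a::semiring_1 mat"
  assumes "A * B = 1\<^sub>m k" "dim_col A = dim_row B" "dim_col B = dim_row X" "dim_row X = k"
  shows "A * (B * X) = X"
  using assms by (simp flip: mult_assoc_dim)

lemma mult_mat_index_sum:
  assumes "i < dim_row A" "j < dim_col B" "dim_col A = dim_row B"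
  shows "(A * B) $$ (i, j) = (\<Sum>k<dim_row B. A $$ (i, k) * B $$ (k, j))"
  using assms by (simp add: scalar_prod_def lessThan_atLeast0)

lemma mult_zero_vec:
  fixes A :: "'a::semiring_0 mat"
  shows "A \<in> carrier_mat m n \<Longrightarrow> A *\<^sub>v 0\<^sub>v n = 0\<^sub>v m"
  by (rule eq_vecI) auto

lemma minv_right_left:
  assumes A: "A \<in> carrier_mat n n" and det: "det A \<noteq> 0"
  shows "minv A \<in> carrier_mat n n" "A * minv A = 1\<^sub>m n" "minv A * A = 1\<^sub>m n"
proof -
  obtain B where B: "mat_inverse A = Some B"
    using mat_inverse(1)[OF A, of "()"] det_non_zero_imp_unit[OF A det, of "()"]
    by (cases "mat_inverse A") auto
  then have "minv A = B" by (simp add: minv_def)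
  with mat_inverse(2)[OF A B]
  show "minv A \<in> carrier_mat n n" "A * minv A = 1\<^sub>m n" "minv A * A = 1\<^sub>m n" by auto
qed

lemma det_nonzero_if_injective:
  fixes A :: "'a::idom mat"
  assumes "A \<in> carrier_mat n n"
    and "\<And>v. v \<in> carrier_vec n \<Longrightarrow> A *\<^sub>v v = 0\<^sub>v n \<Longrightarrow> v = 0\<^sub>v n"
  shows "det A \<noteq> 0"
  using assms det_0_iff_vec_prod_zero by blast

lemma minv_eqI:
  assumes A: "A \<in> carrier_mat n n" and B: "B \<in> carrier_mat n n" and AB: "A * B = 1\<^sub>m n"
  shows "minv A = B"
proof -
  have "det A \<noteq> 0" using det_mult[OF A B] AB by auto
  note minv = minv_right_left[OF A this]
  have "minv A = minv A * (A * B)" using AB minv by simp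
  also have "\<dots> = B" using minv A B by (intro mult_left_cancel) auto
  finally show ?thesis .
qed

lemma invertible_matI_det:
  fixes A :: "real mat"
  assumes "A \<in> carrier_mat n n" "det A \<noteq> 0"
  shows "invertible_mat A"
  using minv_right_left[OF assms] assms
  by (auto simp: invertible_mat_def inverts_mat_def)

section \<open>Kronecker and Khatri-Rao products\<close>

text \<open>
  Reads an index of a Kronecker product as a pair, the first component running fastest.
\<close>
lemma sum_nat_pairs:
  fixes h :: "nat \<Rightarrow> 'a::comm_monoid_add"
  shows "(\<Sum>r<a * b. h r) = (\<Sum>k<b. \<Sum>i<a. h (i + k * a))"
proof -
  have "sum h {k * a..<k * a + a} = (\<Sum>i<a. h (i + k * a))" for k
    using sum.shift_bounds_nat_ivl[of h 0 "k * a" a] by (simp add: add.commute lessThan_atLeast0)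
  then show ?thesis by (simp add: mult.commute[of a b] flip: sum.nat_group)
qed

lemma div_mod_less_mult:
  fixes r :: nat
  assumes "r < a * b"
  shows "r mod a < a" "r div a < b"
  using assms by (cases "a = 0"; simp add: less_mult_imp_div_less mult.commute)+

lemma kronecker_dim [simp]:
  "dim_row (kronecker A B) = dim_row A * dim_row B" "dim_col (kronecker A B) = dim_col A * dim_col B"
  by (simp_all add: kronecker_def)

lemma khatri_rao_dim [simp]:
  "dim_row (khatri_rao A B) = dim_row A * dim_row B" "dim_col (khatri_rao A B) = dim_col A"
  by (simp_all add: khatri_rao_def)

text \<open>
  The mixed-product rule: the double sum over the pairs of inner indices factors.
\<close>
lemma kronecker_mult_kronecker:
  assumes "dim_col A = dim_row C" "dim_col B = dim_row D"
  shows "kronecker A B * kronecker C D = kronecker (A * C) (B * D)"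
proof (rule eq_matI)
  fix r s assume "r < dim_row (kronecker (A * C) (B * D))" "s < dim_col (kronecker (A * C) (B * D))"
  then have r: "r < dim_row A * dim_row B" and s: "s < dim_col C * dim_col D" by simp_all
  note [simp] = div_mod_less_mult[OF r] div_mod_less_mult[OF s]
  have "(kronecker A B * kronecker C D) $$ (r, s) =
      (\<Sum>t<dim_row C * dim_row D. A $$ (r mod dim_row A, t mod dim_row C) * B $$ (r div dim_row A, t div dim_row C)
        * (C $$ (t mod dim_row C, s mod dim_col C) * D $$ (t div dim_row C, s div dim_col C)))"
    using r s assms by (simp add: kronecker_def scalar_prod_def lessThan_atLeast0)
  also have "\<dots> = (\<Sum>k<dim_row D. \<Sum>i<dim_row C. (A $$ (r mod dim_row A, i) * C $$ (i, s mod dim_col C))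
      * (B $$ (r div dim_row A, k) * D $$ (k, s div dim_col C)))"
    by (simp add: sum_nat_pairs mult_ac)
  also have "\<dots> = (A * C) $$ (r mod dim_row A, s mod dim_col C) * (B * D) $$ (r div dim_row A, s div dim_col C)"
    using assms
    by (subst sum.swap) (simp add: mult_mat_index_sum sum_product del: index_mult_mat(1))
  finally show "(kronecker A B * kronecker C D) $$ (r, s) = kronecker (A * C) (B * D) $$ (r, s)"
    using r s by (simp add: kronecker_def)
qed (use assms in simp_all)

lemma kronecker_mult_khatri_rao:
  assumes "dim_col A = dim_row C" "dim_col B = dim_row D" "dim_col C = dim_col D"
  shows "kronecker A B * khatri_rao C D = khatri_rao (A * C) (B * D)"
proof (rule eq_matI)
  fix r s assume "r < dim_row (khatri_rao (A * C) (B * D))" "s < dim_col (khatri_rao (A * C) (B * D))"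
  then have r: "r < dim_row A * dim_row B" and s: "s < dim_col C" by simp_all
  note [simp] = div_mod_less_mult[OF r]
  have "(kronecker A B * khatri_rao C D) $$ (r, s) =
      (\<Sum>t<dim_row C * dim_row D. A $$ (r mod dim_row A, t mod dim_row C) * B $$ (r div dim_row A, t div dim_row C)
        * (C $$ (t mod dim_row C, s) * D $$ (t div dim_row C, s)))"
    using r s assms by (simp add: kronecker_def scalar_prod_def lessThan_atLeast0 khatri_rao_def)
  also have "\<dots> = (\<Sum>k<dim_row D. \<Sum>i<dim_row C. (A $$ (r mod dim_row A, i) * C $$ (i, s))
      * (B $$ (r div dim_row A, k) * D $$ (k, s)))"
    by (simp add: sum_nat_pairs mult_ac)
  also have "\<dots> = (A * C) $$ (r mod dim_row A, s) * (B * D) $$ (r div dim_row A, s)"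
    using assms s
    by (subst sum.swap) (simp add: mult_mat_index_sum sum_product del: index_mult_mat(1))
  finally show "(kronecker A B * khatri_rao C D) $$ (r, s) = khatri_rao (A * C) (B * D) $$ (r, s)"
    using r s by (simp add: khatri_rao_def)
qed (use assms in simp_all)

text \<open>
  Entry \<open>(i, j)\<close> is an inner product of two Kronecker products of columns, hence a product of inner
  products: the Gram matrix of Khatri-Rao products is an entrywise product of Gram matrices.
\<close>
lemma khatri_rao_transpose_mult_khatri_rao:
  assumes "dim_row A = dim_row C" "dim_row B = dim_row D" "dim_col A = dim_col B" "dim_col C = dim_col D"
    and i: "i < dim_col A" and j: "j < dim_col C"
  shows "(transpose_mat (khatri_rao A B) * khatri_rao C D) $$ (i, j)
    = (transpose_mat A * C) $$ (i, j) * (transpose_mat B * D) $$ (i, j)"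
proof -
  have "(transpose_mat (khatri_rao A B) * khatri_rao C D) $$ (i, j)
    = (\<Sum>t<dim_row C * dim_row D. A $$ (t mod dim_row C, i) * B $$ (t div dim_row C, i)
        * (C $$ (t mod dim_row C, j) * D $$ (t div dim_row C, j)))"
    using assms by (simp add: khatri_rao_def scalar_prod_def lessThan_atLeast0)
  also have "\<dots> = (\<Sum>k<dim_row D. \<Sum>p<dim_row C. (A $$ (p, i) * C $$ (p, j))
      * (B $$ (k, i) * D $$ (k, j)))"
    by (simp add: sum_nat_pairs mult_ac)
  also have "\<dots> = (transpose_mat A * C) $$ (i, j) * (transpose_mat B * D) $$ (i, j)"
    using assms
    by (subst sum.swap) (simp add: mult_mat_index_sum sum_product del: index_mult_mat(1))
  finally show ?thesis .
qed

lemma transpose_kronecker: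
  "transpose_mat (kronecker A B) = kronecker (transpose_mat A) (transpose_mat B)"
  by (rule eq_matI) (auto simp: kronecker_def div_mod_less_mult)

text \<open>
  This is where the Khatri-Rao product enters: compressing \<open>L \<otimes> L\<close> with it squares the entries of
  \<open>Q L Q\<^sup>T\<close>, and such squares are the entries of the Hessian. Push \<open>L \<otimes> L\<close> into the right factor
  by the mixed-product rule and take the Gram matrix entrywise.
\<close>
lemma congruence_kronecker_square_index:
  assumes Q: "Q \<in> carrier_mat n l" and L: "L \<in> carrier_mat l l" and i: "i < n" and j: "j < n"
  defines "K \<equiv> khatri_rao (transpose_mat Q) (transpose_mat Q)"
  shows "(transpose_mat K * kronecker L L * K) $$ (i, j) = ((Q * L * transpose_mat Q) $$ (i, j))\<^sup>2"
proof -
  have "transpose_mat K * kronecker L L * K =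
      transpose_mat K * khatri_rao (L * transpose_mat Q) (L * transpose_mat Q)"
    using Q L by (simp add: K_def mult_assoc_dim kronecker_mult_khatri_rao)
  also have "\<dots> $$ (i, j) = (Q * (L * transpose_mat Q)) $$ (i, j) * (Q * (L * transpose_mat Q)) $$ (i, j)"
    unfolding K_def using Q L i j by (subst khatri_rao_transpose_mult_khatri_rao) simp_all
  also have "Q * (L * transpose_mat Q) = Q * L * transpose_mat Q"
    using Q L by (simp add: mult_assoc_dim)
  finally show ?thesis by (simp only: power2_eq_square)
qed

section \<open>Diagonal matrices\<close>

lemma Diag_carrier [simp]: "Diag v \<in> carrier_mat (dim_vec v) (dim_vec v)"
  "dim_row (Diag v) = dim_vec v" "dim_col (Diag v) = dim_vec v"
  by (simp_all add: Diag_def mat_diag_def)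

lemma transpose_Diag [simp]: "transpose_mat (Diag v) = Diag v"
  by (rule eq_matI) (auto simp: Diag_def mat_diag_def)

lemma diag_matrix_index [simp]:
  "i < dim_vec v \<Longrightarrow> j < dim_vec v \<Longrightarrow> Diag v $$ (i, j) = (if i = j then v $ i else 0)"
  by (auto simp: Diag_def mat_diag_def)

lemma Diag_mult_vec:
  fixes d v :: "real vec"
  shows "v \<in> carrier_vec (dim_vec d) \<Longrightarrow> Diag d *\<^sub>v v = vec (dim_vec d) (\<lambda>i. d $ i * v $ i)"
  by (rule eq_vecI) (auto simp: scalar_prod_def if_distrib[of "\<lambda>x. x * _"] cong: if_cong)

lemma Diag_vec_eq_mat_diag: "Diag (vec n f) = mat_diag n f"
  by (rule eq_matI) (auto simp: Diag_def mat_diag_def)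

lemma diag_mat_diag [simp]: "diag (mat_diag n f) = vec n f"
  by (rule eq_vecI) (auto simp: diag_def mat_diag_def)

lemma mat_diag_dims [simp]: "dim_row (mat_diag n f) = n" "dim_col (mat_diag n f) = n"
  by (simp_all add: mat_diag_def)

lemma transpose_mat_diag [simp]: "transpose_mat (mat_diag n f) = mat_diag n f"
  by (rule eq_matI) (auto simp: mat_diag_def)

lemma mat_diag_eq_one: "(\<And>i. i < n \<Longrightarrow> f i = 1) \<Longrightarrow> mat_diag n f = 1\<^sub>m n"
  by (rule eq_matI) (auto simp: mat_diag_def)

lemma inv_sqrt_diag_mat_diag: "inv_sqrt_diag (mat_diag n f) = mat_diag n (\<lambda>i. 1 / sqrt (f i))"
  unfolding inv_sqrt_diag_def diag_mat_diag
  by (rule eq_matI) (auto simp: Diag_def mat_diag_def)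

lemma minv_mat_diag:
  assumes "\<And>i. i < n \<Longrightarrow> f i \<noteq> 0"
  shows "minv (mat_diag n f) = mat_diag n (\<lambda>i. 1 / f i)"
  using assms by (intro minv_eqI[of _ n]) (auto intro: mat_diag_eq_one)

lemma mat_diag_mult_vec:
  fixes v :: "real vec"
  shows "v \<in> carrier_vec n \<Longrightarrow> mat_diag n f *\<^sub>v v = vec n (\<lambda>i. f i * v $ i)"
  using Diag_mult_vec[of v "vec n f"] by (auto simp: Diag_vec_eq_mat_diag)

text \<open>
  The diagonal entries are values of the quadratic form at unit vectors.
\<close>
lemma diagonal_pos_def_mat_diag:
  assumes "diagonal_mat A" "pos_def_mat m A"
  shows "A = mat_diag m (\<lambda>i. A $$ (i, i))" "i < m \<Longrightarrow> 0 < A $$ (i, i)"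
proof -
  have A: "A \<in> carrier_mat m m" using assms by (simp add: pos_def_mat_def)
  show "A = mat_diag m (\<lambda>i. A $$ (i, i))"
    using assms(1) A by (intro eq_matI) (auto simp: mat_diag_def diagonal_mat_def)
  assume i: "i < m"
  then have "unit_vec m i \<bullet> (A *\<^sub>v unit_vec m i) > 0"
    using assms(2) by (simp add: pos_def_mat_def)
  then show "0 < A $$ (i, i)" using A i by simp
qed

section \<open>Inverting the posterior precision matrix\<close>

lemma det_gram_plus_one:
  fixes T :: "real mat"
  assumes T: "T \<in> carrier_mat k p"
  shows "det (T * transpose_mat T + 1\<^sub>m k) \<noteq> 0"
proof (rule det_nonzero_if_injective)
  show "T * transpose_mat T + 1\<^sub>m k \<in> carrier_mat k k" using T by (intro carrier_matI) auto
  fix v :: "real vec"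
  assume v: "v \<in> carrier_vec k" and z: "(T * transpose_mat T + 1\<^sub>m k) *\<^sub>v v = 0\<^sub>v k"
  define u where "u = transpose_mat T *\<^sub>v v"
  have u: "u \<in> carrier_vec p" using T by (intro carrier_vecI) (auto simp: u_def)
  \<comment> \<open>A kernel vector \<open>v\<close> would satisfy \<open>\<bar>T\<^sup>T v\<bar>\<^sup>2 + \<bar>v\<bar>\<^sup>2 = 0\<close>.\<close>
  have "0 = v \<bullet> ((T * transpose_mat T + 1\<^sub>m k) *\<^sub>v v)" using z v by simp
  also have "(T * transpose_mat T + 1\<^sub>m k) *\<^sub>v v = T *\<^sub>v u + v"
    using T v by (simp add: add_mult_distrib_mat_vec[of _ k k] mult_assoc_vec_dim u_def)
  also have "v \<bullet> (T *\<^sub>v u + v) = v \<bullet> (T *\<^sub>v u) + v \<bullet> v"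
    using T v u by (intro scalar_prod_add_distrib[of _ k]) auto
  also have "v \<bullet> (T *\<^sub>v u) = u \<bullet> u"
    using transpose_vec_mult_scalar[OF T u v] by (simp add: u_def)
  finally have s: "u \<bullet> u + v \<bullet> v = 0" by simp
  have "u \<bullet> u \<ge> 0" "v \<bullet> v \<ge> 0" by (simp_all add: scalar_prod_def sum_nonneg)
  with s have "v \<bullet> v = 0" by linarith
  then have "\<forall>i<k. v $ i = 0"
    using v by (auto simp: scalar_prod_def sum_nonneg_eq_0_iff)
  then show "v = 0\<^sub>v k" using v by (intro eq_vecI) auto
qed

text \<open>
  Nonnegativity of the design weights is used here, through their square roots: with
  \<open>Z = R Diag(sqrt w)\<close> one has \<open>L = Z Z\<^sup>T\<close>, so \<open>L \<otimes> L = (Z \<otimes> Z) (Z \<otimes> Z)\<^sup>T\<close>.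
\<close>
lemma gram_factor_of_weighted_kronecker:
  fixes w :: "real vec"
  assumes R: "R \<in> carrier_mat l m" and w: "w \<in> carrier_vec m" "\<forall>i<m. 0 \<le> w $ i"
    and L: "L = R * Diag w * transpose_mat R" and S: "S \<in> carrier_mat k (l * l)"
  obtains T where "T \<in> carrier_mat k (m * m)" "S * kronecker L L * transpose_mat S = T * transpose_mat T"
proof
  define Z where "Z = R * Diag (map_vec sqrt w)"
  define T where "T = S * kronecker Z Z"
  have Z: "dim_row Z = l" "dim_col Z = m" using R w by (simp_all add: Z_def)
  have "Diag (map_vec sqrt w) * Diag (map_vec sqrt w) = Diag w"
    using w by (simp add: Diag_def) (auto simp: mat_diag_def intro!: eq_matI)
  then have "Diag (map_vec sqrt w) * (Diag (map_vec sqrt w) * transpose_mat R) = Diag w * transpose_mat R"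
    using R w by (simp flip: mult_assoc_dim)
  then have LZ: "L = Z * transpose_mat Z"
    using R w by (simp add: L Z_def transpose_mult_dim mult_assoc_dim)
  show "T \<in> carrier_mat k (m * m)" using Z S by (intro carrier_matI) (auto simp: T_def)
  show "S * kronecker L L * transpose_mat S = T * transpose_mat T"
    using Z S
    by (simp add: T_def LZ transpose_mult_dim mult_assoc_dim transpose_kronecker flip: kronecker_mult_kronecker)
qed

text \<open>
  On the range of \<open>Q\<close> the left factor acts as \<open>L + 1\<close>, and on its orthogonal complement as the
  identity; the right factor inverts both parts.
\<close>
lemma inverse_one_plus_orthonormal_update:
  fixes Q L N :: "real mat"
  assumes Q: "Q \<in> carrier_mat n k" and L: "L \<in> carrier_mat k k" and N: "N \<in> carrier_mat k k"
    and QQ: "transpose_mat Q * Q = 1\<^sub>m k" and LN: "(L + 1\<^sub>m k) * N = 1\<^sub>m k"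
  shows "(1\<^sub>m n + Q * L * transpose_mat Q) * (1\<^sub>m n - Q * transpose_mat Q + Q * N * transpose_mat Q)
    = 1\<^sub>m n"
proof -
  let ?T = "transpose_mat Q"
  define Y where "Y = 1\<^sub>m n - Q * ?T + Q * N * ?T"
  have Y: "Y \<in> carrier_mat n n" using Q N by (simp add: Y_def)
  have QT: "Q * ?T \<in> carrier_mat n n" "Q * N * ?T \<in> carrier_mat n n" "Q * (L * (N * ?T)) \<in> carrier_mat n n"
    using Q N L by simp_all
  have "?T * Y = ?T * (1\<^sub>m n - Q * ?T) + ?T * (Q * N * ?T)"
    unfolding Y_def using Q N by (intro mult_add_distrib_mat[of _ k n _ n]) auto
  also have "?T * (1\<^sub>m n - Q * ?T) = ?T - ?T * (Q * ?T)"
    using Q by (subst mult_minus_distrib_mat[of _ k n _ n]) auto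
  also have "?T * (Q * ?T) = ?T"
    using Q QQ by (intro mult_left_cancel) auto
  also have "?T * (Q * N * ?T) = N * ?T"
    using Q N mult_left_cancel[OF QQ, of "N * ?T"] by (simp add: mult_assoc_dim)
  also have "?T - ?T + N * ?T = N * ?T"
    using Q N by (intro eq_matI) auto
  finally have TY: "?T * Y = N * ?T" .
  have "(1\<^sub>m n + Q * L * ?T) * Y = Y + Q * L * ?T * Y"
    using Y Q L add_mult_distrib_mat[of "1\<^sub>m n" n n "Q * L * ?T" Y n] by simp
  also have "Q * L * ?T * Y = Q * (L * (N * ?T))"
    using Y Q L N by (simp add: mult_assoc_dim TY)
  also have "Y + Q * (L * (N * ?T)) = (1\<^sub>m n - Q * ?T + Q * N * ?T) + Q * (L * (N * ?T))"
    by (simp only: Y_def)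
  also have "\<dots> = (1\<^sub>m n - Q * ?T) + (Q * (N * ?T) + Q * (L * (N * ?T)))"
    using Q N L QT by (intro eq_matI) (simp_all add: mult_assoc_dim)
  also have "Q * (N * ?T) + Q * (L * (N * ?T)) = Q * ((L + 1\<^sub>m k) * N * ?T)"
  proof -
    have "(L + 1\<^sub>m k) * N * ?T = L * (N * ?T) + N * ?T"
      using Q L N by (simp add: add_mult_distrib_mat[of _ k k _ _ k] add_mult_distrib_mat[of _ k k _ _ n] mult_assoc_dim)
    also have "Q * \<dots> = Q * (L * (N * ?T)) + Q * (N * ?T)"
      using Q L N by (subst mult_add_distrib_mat[of _ n k _ n]) auto
    also have "\<dots> = Q * (N * ?T) + Q * (L * (N * ?T))"
      using Q L N by (intro comm_add_mat[of _ n n]) auto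
    finally show ?thesis by simp
  qed
  also have "\<dots> = Q * ?T" using LN Q by simp
  also have "1\<^sub>m n - Q * ?T + Q * ?T = 1\<^sub>m n" using Q by (intro eq_matI) auto
  finally show ?thesis by (simp only: Y_def)
qed

text \<open>
  Pulling the square root of the prior precision out of both sides of the posterior precision leaves
  the identity plus \<open>B J B\<^sup>T\<close> with \<open>B = D C M\<^sup>-\<^sup>1 K\<^sup>T = Qh Rh\<close>, that is, an update supported on the range
  of the orthonormal columns of \<open>Qh\<close>, which is inverted in the small dimension \<open>k\<close>.
\<close>
lemma posterior_precision_times_covariance:
  fixes mu :: "nat \<Rightarrow> real" and C K J Qh Rh N :: "real mat"
  assumes mu: "\<And>i. i < n \<Longrightarrow> 0 < mu i"
    and C: "C \<in> carrier_mat n n" "transpose_mat C = C" "det C \<noteq> 0"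
    and K: "K \<in> carrier_mat p n" and J: "J \<in> carrier_mat p p"
    and Qh: "Qh \<in> carrier_mat n k" "transpose_mat Qh * Qh = 1\<^sub>m k" and Rh: "Rh \<in> carrier_mat k p"
    and N: "N \<in> carrier_mat k k" "(Rh * J * transpose_mat Rh + 1\<^sub>m k) * N = 1\<^sub>m k"
  defines "M \<equiv> mat_diag n mu" and "Mi \<equiv> mat_diag n (\<lambda>i. 1 / mu i)" and "D \<equiv> mat_diag n (\<lambda>i. 1 / sqrt (mu i))"
  assumes QR: "Qh * Rh = D * C * Mi * transpose_mat K"
  shows "(Mi * transpose_mat K * J * K + minv C * M * minv C * M)
    * (Mi * C * D * (1\<^sub>m n - Qh * transpose_mat Qh + Qh * N * transpose_mat Qh) * D * C) = 1\<^sub>m n"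
proof -
  define H where "H = mat_diag n (\<lambda>i. sqrt (mu i))"
  define X where "X = 1\<^sub>m n + Qh * (Rh * J * transpose_mat Rh) * transpose_mat Qh"
  define Y where "Y = 1\<^sub>m n - Qh * transpose_mat Qh + Qh * N * transpose_mat Qh"
  have ne: "mu i \<noteq> 0" "0 \<le> mu i" if "i < n" for i using mu[OF that] by auto
  note Ci = minv_right_left[OF C(1,3)]
  have carr: "M \<in> carrier_mat n n" "Mi \<in> carrier_mat n n" "D \<in> carrier_mat n n" "H \<in> carrier_mat n n"
    by (simp_all add: M_def Mi_def D_def H_def)
  note d [simp] = carrier_matD[OF carr(1)] carrier_matD[OF carr(2)] carrier_matD[OF carr(3)] carrier_matD[OF carr(4)]
    carrier_matD[OF C(1)] carrier_matD[OF Ci(1)] carrier_matD[OF K] carrier_matD[OF J]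
    carrier_matD[OF Qh(1)] carrier_matD[OF Rh] carrier_matD[OF N(1)]
  have dXY [simp]: "dim_row X = n" "dim_col X = n" "dim_row Y = n" "dim_col Y = n"
    by (simp_all add: X_def Y_def)
  have HD: "H * D = 1\<^sub>m n" "D * H = 1\<^sub>m n" and MMi: "M * Mi = 1\<^sub>m n" "Mi * M = 1\<^sub>m n" and HH: "H * H = M"
    using ne by (auto simp: M_def Mi_def D_def H_def intro!: mat_diag_eq_one)
       (auto simp: mat_diag_def intro!: eq_matI)
  have tr: "transpose_mat D = D" "transpose_mat Mi = Mi" by (simp_all add: D_def Mi_def)
  \<comment> \<open>With \<open>mult_assoc_dim\<close> every product is nested to the right; these rules cancel
      adjacent inverse factors in such a product.\<close>
  note cancel [simp] = mult_left_cancel[OF HD(1)] mult_left_cancel[OF HD(2)] mult_left_cancel[OF MMi(1)]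
    mult_left_cancel[OF MMi(2)] mult_left_cancel[OF Ci(2)] mult_left_cancel[OF Ci(3)]
  have XY: "X * Y = 1\<^sub>m n"
    unfolding X_def Y_def using Qh N Rh J by (intro inverse_one_plus_orthonormal_update) (auto intro!: carrier_matI)
  have QRt: "transpose_mat Rh * transpose_mat Qh = K * (Mi * (C * D))"
  proof -
    have "transpose_mat Rh * transpose_mat Qh = transpose_mat (Qh * Rh)" by (simp add: transpose_mult_dim)
    also have "\<dots> = K * (Mi * (C * D))" by (simp add: QR transpose_mult_dim tr C(2) mult_assoc_dim)
    finally show ?thesis .
  qed
  \<comment> \<open>The precision is \<open>X\<close> between \<open>minv C * H\<close> and \<open>H * minv C * M\<close>, which are the inverses of the
      outer factors \<open>D * C\<close> and \<open>Mi * C * D\<close> of the covariance.\<close>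
  have "X * (H * (minv C * M)) = H * (minv C * M) + Qh * Rh * J * (transpose_mat Rh * transpose_mat Qh) * (H * (minv C * M))"
    unfolding X_def
    by (subst add_mult_distrib_mat[of _ n n _ _ n]) (auto simp: mult_assoc_dim)
  also have "\<dots> = H * (minv C * M) + D * (C * (Mi * (transpose_mat K * (J * K))))"
    unfolding QRt QR by (simp add: mult_assoc_dim MMi)
  finally have "minv C * H * (X * (H * (minv C * M)))
    = minv C * (H * (H * (minv C * M))) + Mi * (transpose_mat K * (J * K))"
    by (simp add: mult_add_distrib_dim mult_assoc_dim)
  also have "H * (H * (minv C * M)) = M * (minv C * M)" by (simp flip: HH mult_assoc_dim)
  also have "minv C * (M * (minv C * M)) + Mi * (transpose_mat K * (J * K))
      = Mi * transpose_mat K * J * K + minv C * M * minv C * M"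
    by (subst comm_add_mat[of _ n n]) (auto simp: mult_assoc_dim)
  finally have P: "Mi * transpose_mat K * J * K + minv C * M * minv C * M
      = minv C * (H * (X * (H * (minv C * M))))" by (simp add: mult_assoc_dim)
  show ?thesis
    unfolding P Y_def[symmetric]
    using mult_left_cancel[OF XY] by (simp add: mult_assoc_dim Ci)
qed

section \<open>Piecewise constant functions and linear maps on them\<close>

text \<open>
  The action on coefficient vectors alone: in this form composition, sum and inverse of operators
  pass to the matrices at once. On a mesh it already forces \<open>X\<close> to be the inverse mass matrix times
  the Gram matrix of the operator (\<open>has_matrix_rep_if_represents\<close>).
\<close>
definition represents_on_Vh ::
    "nat \<Rightarrow> (nat \<Rightarrow> 'd set) \<Rightarrow> (('d \<Rightarrow> real) \<Rightarrow> ('d \<Rightarrow> real)) \<Rightarrow> real mat \<Rightarrow> bool" where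
  "represents_on_Vh n E A X \<longleftrightarrow> X \<in> carrier_mat n n \<and>
     (\<forall>g \<in> carrier_vec n. A (fe_fun n E g) = fe_fun n E (X *\<^sub>v g))"

lemma phi_eq_fe_fun: "i < n \<Longrightarrow> phi E i = fe_fun n E (unit_vec n i)"
  by (auto simp: fe_fun_def fun_eq_iff if_distrib[of "\<lambda>x. x * _"] cong: if_cong)

lemma fe_fun_in_Vh [simp]: "g \<in> carrier_vec n \<Longrightarrow> fe_fun n E g \<in> Vh n E"
  by (simp add: Vh_def)

lemma VhE:
  assumes "f \<in> Vh n E"
  obtains g where "g \<in> carrier_vec n" "f = fe_fun n E g"
  using assms by (auto simp: Vh_def)

lemma fe_fun_add:
  "g \<in> carrier_vec n \<Longrightarrow> h \<in> carrier_vec n \<Longrightarrow> (\<lambda>x. fe_fun n E g x + fe_fun n E h x) = fe_fun n E (g + h)"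
  by (auto simp: fe_fun_def fun_eq_iff sum.distrib algebra_simps)

lemma fe_fun_scale:
  "g \<in> carrier_vec n \<Longrightarrow> (\<lambda>x. c * fe_fun n E g x) = fe_fun n E (c \<cdot>\<^sub>v g)"
  by (auto simp: fe_fun_def fun_eq_iff sum_distrib_left mult_ac)

lemma fe_fun_zero: "fe_fun n E (0\<^sub>v n) = (\<lambda>x. 0)"
  by (auto simp: fe_fun_def fun_eq_iff)

lemma truncated_vec_Suc:
  fixes g :: "real vec"
  assumes "g \<in> carrier_vec n" "k < n"
  shows "vec n (\<lambda>i. if i < Suc k then g $ i else 0)
    = vec n (\<lambda>i. if i < k then g $ i else 0) + (g $ k) \<cdot>\<^sub>v unit_vec n k"
  using assms by (intro eq_vecI) (auto simp: less_Suc_eq)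

text \<open>
  Induction along the basis expansion; it carries linear maps from basis functions to all
  coefficient vectors.
\<close>
lemma vec_induct_units:
  fixes g :: "real vec"
  assumes g: "g \<in> carrier_vec n"
    and zero: "P (0\<^sub>v n)"
    and step: "\<And>h c k. h \<in> carrier_vec n \<Longrightarrow> P h \<Longrightarrow> k < n \<Longrightarrow> P (h + c \<cdot>\<^sub>v unit_vec n k)"
  shows "P g"
proof -
  have "k \<le> n \<Longrightarrow> P (vec n (\<lambda>i. if i < k then g $ i else 0))" for k
  proof (induction k)
    case 0
    have "vec n (\<lambda>i. if i < 0 then g $ i else 0) = 0\<^sub>v n" by (rule eq_vecI) auto
    then show ?case using zero by simp
  next
    case (Suc k)
    then show ?case using truncated_vec_Suc[OF g] step by simp
  qed
  moreover have "vec n (\<lambda>i. if i < n then g $ i else 0) = g" using g by (intro eq_vecI) auto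
  ultimately show ?thesis by (metis order_refl)
qed

text \<open>
  The columns of the matrix are the coefficient vectors of the images of the basis functions.
\<close>
lemma linear_Vh_represented:
  assumes A: "linear_Vh n E A"
  obtains X where "represents_on_Vh n E A X"
proof -
  have "\<exists>a. a \<in> carrier_vec n \<and> A (phi E j) = fe_fun n E a" if "j < n" for j
  proof -
    have "A (phi E j) \<in> Vh n E" using A that by (simp add: linear_Vh_def phi_eq_fe_fun)
    then show ?thesis by (auto simp: Vh_def)
  qed
  then obtain a where a: "\<And>j. j < n \<Longrightarrow> a j \<in> carrier_vec n \<and> A (phi E j) = fe_fun n E (a j)" by metis
  define X where "X = mat n n (\<lambda>(i, j). a j $ i)"
  have X: "X \<in> carrier_mat n n" by (simp add: X_def)
  have Xunit: "X *\<^sub>v unit_vec n k = a k" if "k < n" for k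
    using that a[OF that] X by (intro eq_vecI) (auto simp: X_def scalar_prod_right_unit)
  have "A (fe_fun n E g) = fe_fun n E (X *\<^sub>v g)" if "g \<in> carrier_vec n" for g
    using that
  proof (rule vec_induct_units)
    have "A (\<lambda>x. 0 * fe_fun n E (0\<^sub>v n) x) = (\<lambda>x. 0 * A (fe_fun n E (0\<^sub>v n)) x)"
      using A unfolding linear_Vh_def by (meson fe_fun_in_Vh zero_carrier_vec)
    moreover have "X *\<^sub>v 0\<^sub>v n = 0\<^sub>v n" using X by (rule mult_zero_vec)
    ultimately show "A (fe_fun n E (0\<^sub>v n)) = fe_fun n E (X *\<^sub>v 0\<^sub>v n)"
      by (simp add: fe_fun_zero)
  next
    fix h c k assume h: "h \<in> carrier_vec n" and IH: "A (fe_fun n E h) = fe_fun n E (X *\<^sub>v h)" and k: "k < n"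
    have "A (fe_fun n E (h + c \<cdot>\<^sub>v unit_vec n k)) = A (\<lambda>x. fe_fun n E h x + fe_fun n E (c \<cdot>\<^sub>v unit_vec n k) x)"
      using h by (simp add: fe_fun_add)
    also have "\<dots> = (\<lambda>x. A (fe_fun n E h) x + A (fe_fun n E (c \<cdot>\<^sub>v unit_vec n k)) x)"
      using A h unfolding linear_Vh_def by simp
    also have "A (fe_fun n E (c \<cdot>\<^sub>v unit_vec n k)) = A (\<lambda>x. c * phi E k x)"
      using k by (simp add: fe_fun_scale phi_eq_fe_fun)
    also have "\<dots> = (\<lambda>x. c * A (phi E k) x)"
      using A k unfolding linear_Vh_def by (simp add: phi_eq_fe_fun)
    also have "\<dots> = fe_fun n E (c \<cdot>\<^sub>v a k)" using a k by (simp add: fe_fun_scale)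
    also have "(\<lambda>x. A (fe_fun n E h) x + fe_fun n E (c \<cdot>\<^sub>v a k) x) = fe_fun n E (X *\<^sub>v h + c \<cdot>\<^sub>v a k)"
      using X a k IH h by (simp add: fe_fun_add)
    also have "X *\<^sub>v h + c \<cdot>\<^sub>v a k = X *\<^sub>v (h + c \<cdot>\<^sub>v unit_vec n k)"
      using X h k Xunit by (simp add: mult_add_distrib_mat_vec[of _ n n] mult_mat_vec[of _ n n])
    finally show "A (fe_fun n E (h + c \<cdot>\<^sub>v unit_vec n k)) = fe_fun n E (X *\<^sub>v (h + c \<cdot>\<^sub>v unit_vec n k))" .
  qed
  then show ?thesis using X that by (auto simp: represents_on_Vh_def)
qed

lemma linear_Vh_vec_fe_fun:
  assumes A: "linear_Vh_vec n E m A" and g: "g \<in> carrier_vec n"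
  shows "A (fe_fun n E g) = matrix_of_fwd n E m A *\<^sub>v g"
proof -
  let ?F = "matrix_of_fwd n E m A"
  have F: "?F \<in> carrier_mat m n" by (simp add: matrix_of_fwd_def)
  have Ain: "A (fe_fun n E g) \<in> carrier_vec m" if "g \<in> carrier_vec n" for g
    using A that by (simp add: linear_Vh_vec_def)
  have Funit: "?F *\<^sub>v unit_vec n k = A (phi E k)" if "k < n" for k
    using that F Ain[of "unit_vec n k"] by (intro eq_vecI) (auto simp: matrix_of_fwd_def phi_eq_fe_fun)
  show ?thesis
    using g
  proof (rule vec_induct_units)
    have "A (\<lambda>x. 0 * fe_fun n E (0\<^sub>v n) x) = 0 \<cdot>\<^sub>v A (fe_fun n E (0\<^sub>v n))"
      using A unfolding linear_Vh_vec_def by (meson fe_fun_in_Vh zero_carrier_vec)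
    moreover have "?F *\<^sub>v 0\<^sub>v n = 0\<^sub>v m" using F by (rule mult_zero_vec)
    moreover have "0 \<cdot>\<^sub>v A (fe_fun n E (0\<^sub>v n)) = 0\<^sub>v m"
      using Ain[of "0\<^sub>v n"] by (intro eq_vecI) auto
    ultimately show "A (fe_fun n E (0\<^sub>v n)) = ?F *\<^sub>v 0\<^sub>v n"
      by (simp add: fe_fun_zero)
  next
    fix h c k assume h: "h \<in> carrier_vec n" and IH: "A (fe_fun n E h) = ?F *\<^sub>v h" and k: "k < n"
    have "A (fe_fun n E (h + c \<cdot>\<^sub>v unit_vec n k)) = A (\<lambda>x. fe_fun n E h x + fe_fun n E (c \<cdot>\<^sub>v unit_vec n k) x)"
      using h by (simp add: fe_fun_add)
    also have "\<dots> = A (fe_fun n E h) + A (fe_fun n E (c \<cdot>\<^sub>v unit_vec n k))"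
      using A h unfolding linear_Vh_vec_def by simp
    also have "A (fe_fun n E (c \<cdot>\<^sub>v unit_vec n k)) = A (\<lambda>x. c * phi E k x)"
      using k by (simp add: fe_fun_scale phi_eq_fe_fun)
    also have "\<dots> = c \<cdot>\<^sub>v A (phi E k)"
      using A k unfolding linear_Vh_vec_def by (simp add: phi_eq_fe_fun)
    also have "A (fe_fun n E h) + c \<cdot>\<^sub>v A (phi E k) = ?F *\<^sub>v (h + c \<cdot>\<^sub>v unit_vec n k)"
      using F h k Funit IH by (simp add: mult_add_distrib_mat_vec[of _ m n] mult_mat_vec[of _ m n])
    finally show "A (fe_fun n E (h + c \<cdot>\<^sub>v unit_vec n k)) = ?F *\<^sub>v (h + c \<cdot>\<^sub>v unit_vec n k)" .
  qed
qed

lemma represents_on_Vh_carrier: "represents_on_Vh n E A X \<Longrightarrow> X \<in> carrier_mat n n"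
  by (simp add: represents_on_Vh_def)

lemma represents_on_Vh_apply:
  "represents_on_Vh n E A X \<Longrightarrow> g \<in> carrier_vec n \<Longrightarrow> A (fe_fun n E g) = fe_fun n E (X *\<^sub>v g)"
  by (simp add: represents_on_Vh_def)

lemma represents_on_Vh_comp:
  assumes "represents_on_Vh n E A X" "represents_on_Vh n E B Y"
  shows "represents_on_Vh n E (A \<circ> B) (X * Y)"
  using assms by (auto simp: represents_on_Vh_def)

lemma represents_on_Vh_add:
  assumes "represents_on_Vh n E A X" "represents_on_Vh n E B Y"
  shows "represents_on_Vh n E (\<lambda>q x. A q x + B q x) (X + Y)"
  using assms by (auto simp: represents_on_Vh_def fe_fun_add add_mult_distrib_mat_vec[of _ n n])

section \<open>Operators on a mesh\<close>

context
  fixes Omega :: "'d::euclidean_space set" and E :: "nat \<Rightarrow> 'd set" and n :: nat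
  assumes mesh: "is_mesh Omega n E"
begin

lemma element_measure_pos: "i < n \<Longrightarrow> 0 < measure lebesgue (E i)"
  using mesh by (simp add: is_mesh_def)

lemma phi_times_phi:
  "i < n \<Longrightarrow> j < n \<Longrightarrow> phi E i x * phi E j x = (if i = j then phi E i x else 0)"
  using mesh by (auto simp: is_mesh_def phi_def indicator_def disjoint_family_on_def)

lemma fe_fun_on_element:
  assumes "i < n" "x \<in> E i"
  shows "fe_fun n E g x = g $ i"
proof -
  have "fe_fun n E g x = (\<Sum>j<n. g $ j * (phi E j x * phi E i x))"
    using assms by (simp add: fe_fun_def phi_def)
  also have "\<dots> = (\<Sum>j<n. if j = i then g $ i else 0)"
    using assms by (intro sum.cong) (auto simp: phi_times_phi, auto simp: phi_def)
  finally show ?thesis using assms by simp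
qed

text \<open>
  Elements of positive measure are nonempty, so each coefficient is a value of the function.
\<close>
lemma fe_fun_cancel:
  assumes "g \<in> carrier_vec n" "h \<in> carrier_vec n" "fe_fun n E g = fe_fun n E h"
  shows "g = h"
proof (rule eq_vecI)
  fix i assume i: "i < dim_vec h"
  then have "i < n" using assms by simp
  then have "E i \<noteq> {}" using element_measure_pos[of i] by auto
  then obtain x where "x \<in> E i" by blast
  then show "g $ i = h $ i" using fe_fun_on_element[OF \<open>i < n\<close>, of x] assms(3) by metis
qed (use assms in simp)

text \<open>
  The elements are disjoint, so products of basis functions vanish off the diagonal.
\<close>
lemma fe_fun_mult:
  "fe_fun n E g x * fe_fun n E h x = fe_fun n E (vec n (\<lambda>i. g $ i * h $ i)) x"
proof -
  have "fe_fun n E g x * fe_fun n E h x = (\<Sum>i<n. \<Sum>j<n. g $ i * h $ j * (phi E i x * phi E j x))"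
    by (simp add: fe_fun_def sum_product mult_ac)
  also have "\<dots> = (\<Sum>i<n. \<Sum>j<n. if i = j then g $ i * h $ i * phi E i x else 0)"
    by (intro sum.cong) (auto simp: phi_times_phi)
  finally show ?thesis by (simp add: fe_fun_def)
qed

lemma L2_inner_fe_fun:
  "L2_inner Omega (fe_fun n E g) (fe_fun n E h) = (\<Sum>i<n. measure lebesgue (E i) * (g $ i * h $ i))"
proof -
  have ind: "indicator Omega x * phi E i x = indicator (E i) x" if "i < n" for i x
    using that mesh by (auto simp: is_mesh_def phi_def indicator_def)
  have lm: "E i \<in> lmeasurable" if "i < n" for i using that mesh by (simp add: is_mesh_def)
  have "indicator Omega x * fe_fun n E c x = (\<Sum>i<n. c $ i * indicator (E i) x)" for c x
    unfolding fe_fun_def sum_distrib_left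
    by (intro sum.cong refl) (simp add: mult.left_commute[of "indicator Omega _"] ind)
  then have "L2_inner Omega (fe_fun n E g) (fe_fun n E h)
      = (LINT x|lebesgue. (\<Sum>i<n. vec n (\<lambda>i. g $ i * h $ i) $ i * indicator (E i) x))"
    by (simp only: L2_inner_def set_lebesgue_integral_def fe_fun_mult real_scaleR_def)
  also have "\<dots> = (LINT x|lebesgue. (\<Sum>i<n. g $ i * h $ i * indicator (E i) x))"
    by (intro Bochner_Integration.integral_cong refl sum.cong) simp
  also have "\<dots> = (\<Sum>i<n. LINT x|lebesgue. g $ i * h $ i * indicator (E i) x)"
    using lm
    by (intro Bochner_Integration.integral_sum integrable_mult_right integrable_real_indicator)
       (auto simp: fmeasurable_def simp del: emeasure_completion)
  finally show ?thesis using lm by (simp add: mult_ac)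
qed

lemma gram_of_represents:
  assumes "represents_on_Vh n E A X"
  shows "gram Omega n E A = mat n n (\<lambda>(i, j). measure lebesgue (E i) * X $$ (i, j))"
proof (rule eq_matI)
  fix i j assume "i < dim_row (mat n n (\<lambda>(i, j). measure lebesgue (E i) * X $$ (i, j)))"
    "j < dim_col (mat n n (\<lambda>(i, j). measure lebesgue (E i) * X $$ (i, j)))"
  then have ij: "i < n" "j < n" by simp_all
  have X: "X \<in> carrier_mat n n" using assms by (rule represents_on_Vh_carrier)
  have "gram Omega n E A $$ (i, j) = (\<Sum>k<n. measure lebesgue (E k) * ((X *\<^sub>v unit_vec n j) $ k * unit_vec n i $ k))"
    using ij assms by (simp add: gram_def phi_eq_fe_fun represents_on_Vh_apply L2_inner_fe_fun)
  also have "\<dots> = (\<Sum>k<n. if k = i then measure lebesgue (E i) * X $$ (i, j) else 0)"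
    using ij X by (intro sum.cong) auto
  finally show "gram Omega n E A $$ (i, j) = mat n n (\<lambda>(i, j). measure lebesgue (E i) * X $$ (i, j)) $$ (i, j)"
    using ij by simp
qed (simp_all add: gram_def)

text \<open>
  On the diagonal of the kernel only the terms \<open>\<phi>\<^sub>i \<phi>\<^sub>i\<close> survive. One of the two inverse measures of the
  kernel cancels against the mass matrix in the Gram matrix, the other one remains.
\<close>
lemma diag_op_of_represents:
  assumes "represents_on_Vh n E A X"
  shows "diag_op Omega n E A = fe_fun n E (vec n (\<lambda>i. X $$ (i, i) / measure lebesgue (E i)))"
proof
  fix x
  have "diag_op Omega n E A x = (\<Sum>i<n. \<Sum>j<n. inverse (measure lebesgue (E i)) *
      (measure lebesgue (E i) * X $$ (i, j)) * inverse (measure lebesgue (E j)) * (phi E i x * phi E j x))"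
    by (simp add: diag_op_def kernel_def gram_of_represents[OF assms] mult_ac)
  also have "\<dots> = (\<Sum>i<n. \<Sum>j<n. if i = j then X $$ (i, i) / measure lebesgue (E i) * phi E i x else 0)"
    using element_measure_pos by (intro sum.cong refl) (auto simp: phi_times_phi divide_inverse dest: less_imp_neq)
  finally show "diag_op Omega n E A x = fe_fun n E (vec n (\<lambda>i. X $$ (i, i) / measure lebesgue (E i))) x"
    by (simp add: fe_fun_def)
qed

text \<open>
  Testing with the basis functions shows that these coefficients are the only possible ones, so the
  definite description is justified.
\<close>
lemma L2_adjoint_eq:
  assumes F: "F \<in> carrier_mat m n" and A: "\<And>g. g \<in> carrier_vec n \<Longrightarrow> A (fe_fun n E g) = F *\<^sub>v g"
    and y: "y \<in> carrier_vec m"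
  shows "L2_adjoint Omega n E A y
    = fe_fun n E (vec n (\<lambda>j. (transpose_mat F *\<^sub>v y) $ j / measure lebesgue (E j)))"
  unfolding L2_adjoint_def
proof (rule the_equality)
  let ?c = "vec n (\<lambda>j. (transpose_mat F *\<^sub>v y) $ j / measure lebesgue (E j))"
  have adj: "A (fe_fun n E g) \<bullet> y = (\<Sum>j<n. g $ j * (transpose_mat F *\<^sub>v y) $ j)"
    if g: "g \<in> carrier_vec n" for g
  proof -
    have "(transpose_mat F *\<^sub>v y) \<bullet> g = y \<bullet> (F *\<^sub>v g)"
      using transpose_vec_mult_scalar[OF F g y] .
    also have "\<dots> = (F *\<^sub>v g) \<bullet> y" using F g y by (intro comm_scalar_prod[of _ m]) auto
    finally show ?thesis
      using F g y by (simp add: A scalar_prod_def lessThan_atLeast0 mult_ac)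
  qed
  have "L2_inner Omega (fe_fun n E g) (fe_fun n E ?c) = A (fe_fun n E g) \<bullet> y" if "g \<in> carrier_vec n" for g
    unfolding L2_inner_fe_fun adj[OF that]
    using element_measure_pos by (intro sum.cong) (auto simp: less_le)
  then show "fe_fun n E ?c \<in> Vh n E \<and> (\<forall>f \<in> Vh n E. L2_inner Omega f (fe_fun n E ?c) = A f \<bullet> y)"
    by (auto elim!: VhE)
  fix h assume h: "h \<in> Vh n E \<and> (\<forall>f \<in> Vh n E. L2_inner Omega f h = A f \<bullet> y)"
  then obtain b where b: "b \<in> carrier_vec n" "h = fe_fun n E b" by (auto elim: VhE)
  have "b = ?c"
  proof (rule eq_vecI)
    fix j assume "j < dim_vec ?c"
    then have j: "j < n" by simp
    have "L2_inner Omega (fe_fun n E (unit_vec n j)) (fe_fun n E b) = A (fe_fun n E (unit_vec n j)) \<bullet> y"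
      using h b by simp
    moreover have "(\<Sum>i<n. measure lebesgue (E i) * (unit_vec n j $ i * b $ i)) = measure lebesgue (E j) * b $ j"
      using j by (simp add: if_distrib[of "\<lambda>x. x * _"] if_distrib[of "\<lambda>x. _ * x"] cong: if_cong)
    moreover have "(\<Sum>i<n. unit_vec n j $ i * (transpose_mat F *\<^sub>v y) $ i) = (transpose_mat F *\<^sub>v y) $ j"
      using j by (simp add: if_distrib[of "\<lambda>x. x * _"] cong: if_cong)
    ultimately have "measure lebesgue (E j) * b $ j = (transpose_mat F *\<^sub>v y) $ j"
      by (simp add: L2_inner_fe_fun adj)
    then show "b $ j = ?c $ j" using j element_measure_pos[OF j] by (simp add: field_simps)
  qed (use b in simp)
  then show "h = fe_fun n E ?c" using b by simp
qed

text \<open>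
  A right inverse suffices because the matrices are square.
\<close>
lemma represents_on_Vh_inverse:
  assumes A: "represents_on_Vh n E A X" and Y: "Y \<in> carrier_mat n n" and XY: "X * Y = 1\<^sub>m n"
  shows "bij_betw A (Vh n E) (Vh n E)" "represents_on_Vh n E (inv_op n E A) Y"
proof -
  note X = represents_on_Vh_carrier[OF A]
  have YX: "Y * X = 1\<^sub>m n" using mat_mult_left_right_inverse[OF X Y XY] .
  have AY: "A (fe_fun n E (Y *\<^sub>v g)) = fe_fun n E g" if g: "g \<in> carrier_vec n" for g
    using represents_on_Vh_apply[OF A, of "Y *\<^sub>v g"] Y g XY X
    by (simp flip: assoc_mult_mat_vec[OF X Y g])
  have inj: "inj_on A (Vh n E)"
  proof (rule inj_onI)
    fix f h assume "f \<in> Vh n E" "h \<in> Vh n E" and eq: "A f = A h"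
    then obtain a b where ab: "a \<in> carrier_vec n" "f = fe_fun n E a" "b \<in> carrier_vec n" "h = fe_fun n E b"
      by (metis VhE)
    then have "X *\<^sub>v a = X *\<^sub>v b"
      using eq X by (intro fe_fun_cancel) (auto simp: represents_on_Vh_apply[OF A])
    then have "Y * X *\<^sub>v a = Y * X *\<^sub>v b" using ab by (simp add: assoc_mult_mat_vec[OF Y X])
    then show "f = h" using ab YX by simp
  qed
  moreover have "A ` Vh n E = Vh n E"
  proof
    show "A ` Vh n E \<subseteq> Vh n E" using X by (auto elim!: VhE simp: represents_on_Vh_apply[OF A])
    show "Vh n E \<subseteq> A ` Vh n E"
    proof
      fix f assume "f \<in> Vh n E"
      then obtain g where "g \<in> carrier_vec n" "f = fe_fun n E g" by (rule VhE)
      then show "f \<in> A ` Vh n E" using AY[of g] Y by (intro image_eqI[of _ _ "fe_fun n E (Y *\<^sub>v g)"]) auto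
    qed
  qed
  ultimately show "bij_betw A (Vh n E) (Vh n E)" by (simp add: bij_betw_def)
  show "represents_on_Vh n E (inv_op n E A) Y"
    unfolding represents_on_Vh_def inv_op_def
    using Y AY by (auto intro!: inv_into_f_eq[OF inj])
qed

lemma represents_on_Vh_Diag_op:
  assumes "q \<in> carrier_vec n"
  shows "represents_on_Vh n E (Diag_op (fe_fun n E q)) (Diag q)"
  using assms by (auto simp: represents_on_Vh_def Diag_op_def fe_fun_mult Diag_mult_vec fun_eq_iff)

lemma gram_symmetric:
  assumes "self_adjoint Omega n E A"
  shows "transpose_mat (gram Omega n E A) = gram Omega n E A"
proof (rule eq_matI)
  fix i j assume "i < dim_row (gram Omega n E A)" "j < dim_col (gram Omega n E A)"
  then have ij: "i < n" "j < n" by (simp_all add: gram_def)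
  then have "L2_inner Omega (A (phi E i)) (phi E j) = L2_inner Omega (phi E i) (A (phi E j))"
    using assms by (simp add: self_adjoint_def phi_eq_fe_fun)
  then show "transpose_mat (gram Omega n E A) $$ (i, j) = gram Omega n E A $$ (i, j)"
    using ij by (simp add: gram_def L2_inner_def mult.commute)
qed (simp_all add: gram_def)

text \<open>
  If the root annihilates a function, so does its square, which is positive definite.
\<close>
lemma pos_def_op_sqrt_matrix_nonsingular:
  assumes A: "pos_def_op Omega n E A" and S: "\<And>f. f \<in> Vh n E \<Longrightarrow> S (S f) = A f"
    and X: "represents_on_Vh n E S X"
  shows "det X \<noteq> 0"
proof (rule det_nonzero_if_injective)
  note Xc = represents_on_Vh_carrier[OF X]
  show "X \<in> carrier_mat n n" by (fact Xc)
  fix v :: "real vec" assume v: "v \<in> carrier_vec n" and "X *\<^sub>v v = 0\<^sub>v n"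
  then have "A (fe_fun n E v) = fe_fun n E (0\<^sub>v n)"
    using S[of "fe_fun n E v"] Xc mult_zero_vec[OF Xc]
    by (simp add: represents_on_Vh_apply[OF X])
  then have "L2_inner Omega (A (fe_fun n E v)) (fe_fun n E v) = 0" by (simp add: L2_inner_fe_fun)
  then have "fe_fun n E v = fe_fun n E (0\<^sub>v n)"
    using A v unfolding pos_def_op_def fe_fun_zero by force
  then show "v = 0\<^sub>v n" using v by (intro fe_fun_cancel) auto
qed

text \<open>
  The misfit operator and the operator in the data term of the mean are both of this form, the latter
  for the weighted forward map.
\<close>
lemma normal_operator_represented:
  assumes F: "F \<in> carrier_mat m n" and A: "\<And>g. g \<in> carrier_vec n \<Longrightarrow> A (fe_fun n E g) = F *\<^sub>v g"
    and N: "N \<in> carrier_mat m m"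
  shows "represents_on_Vh n E (\<lambda>f. L2_adjoint Omega n E A (N *\<^sub>v A f))
    (mat_diag n (\<lambda>i. 1 / measure lebesgue (E i)) * transpose_mat F * N * F)"
  unfolding represents_on_Vh_def
proof (intro conjI ballI)
  let ?Mi = "mat_diag n (\<lambda>i. 1 / measure lebesgue (E i))"
  show "?Mi * transpose_mat F * N * F \<in> carrier_mat n n"
    using F by (intro carrier_matI) auto
  fix g :: "real vec" assume g: "g \<in> carrier_vec n"
  have y: "N *\<^sub>v (F *\<^sub>v g) \<in> carrier_vec m" using N by (intro carrier_vecI) auto
  have v: "transpose_mat F *\<^sub>v (N *\<^sub>v (F *\<^sub>v g)) \<in> carrier_vec n" using F by (intro carrier_vecI) auto
  have "L2_adjoint Omega n E A (N *\<^sub>v A (fe_fun n E g))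
    = fe_fun n E (vec n (\<lambda>j. (transpose_mat F *\<^sub>v (N *\<^sub>v (F *\<^sub>v g))) $ j / measure lebesgue (E j)))"
    using L2_adjoint_eq[OF F A y] A[OF g] by simp
  also have "vec n (\<lambda>j. (transpose_mat F *\<^sub>v (N *\<^sub>v (F *\<^sub>v g))) $ j / measure lebesgue (E j))
      = ?Mi *\<^sub>v (transpose_mat F *\<^sub>v (N *\<^sub>v (F *\<^sub>v g)))"
    unfolding mat_diag_mult_vec[OF v] by simp
  also have "\<dots> = ?Mi * transpose_mat F * N * F *\<^sub>v g"
    using F N g by (simp add: mult_assoc_dim mult_assoc_vec_dim)
  finally show "L2_adjoint Omega n E A (N *\<^sub>v A (fe_fun n E g)) = fe_fun n E (?Mi * transpose_mat F * N * F *\<^sub>v g)" .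
qed

text \<open>
  The diagonal of \<open>S Diag(q) S\<close> is linear in \<open>q\<close>; up to division by the element measures, its
  coefficients are the entrywise product of \<open>S\<close> and \<open>S\<^sup>T\<close>. Applied to the misfit operator this is the Hessian.
\<close>
lemma diag_op_of_sandwich_represented:
  assumes S: "represents_on_Vh n E A S"
  shows "represents_on_Vh n E (\<lambda>q. diag_op Omega n E (A \<circ> Diag_op q \<circ> A))
    (mat n n (\<lambda>(i, j). S $$ (i, j) * S $$ (j, i) / measure lebesgue (E i)))"
  unfolding represents_on_Vh_def
proof (intro conjI ballI)
  let ?H = "mat n n (\<lambda>(i, j). S $$ (i, j) * S $$ (j, i) / measure lebesgue (E i))"
  note Sc = represents_on_Vh_carrier[OF S]
  fix q :: "real vec" assume q: "q \<in> carrier_vec n"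
  have "represents_on_Vh n E (A \<circ> Diag_op (fe_fun n E q) \<circ> A) (S * Diag q * S)"
    by (intro represents_on_Vh_comp S represents_on_Vh_Diag_op q)
  note diag_op_of_represents[OF this]
  also have "vec n (\<lambda>i. (S * Diag q * S) $$ (i, i) / measure lebesgue (E i)) = ?H *\<^sub>v q"
  proof (rule eq_vecI)
    fix i assume "i < dim_vec (?H *\<^sub>v q)"
    then have i: "i < n" by simp
    have "S * Diag q = mat n n (\<lambda>(i, j). S $$ (i, j) * q $ j)"
      using q mat_diag_mult_right[OF Sc, of "\<lambda>j. q $ j"] by (simp add: Diag_def)
    then have "(S * Diag q * S) $$ (i, i) = (\<Sum>j<n. S $$ (i, j) * q $ j * S $$ (j, i))"
      using Sc i by (simp add: scalar_prod_def lessThan_atLeast0)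
    then show "vec n (\<lambda>i. (S * Diag q * S) $$ (i, i) / measure lebesgue (E i)) $ i = (?H *\<^sub>v q) $ i"
      using i q by (simp add: scalar_prod_def lessThan_atLeast0 sum_divide_distrib mult_ac)
  qed simp
  finally show "diag_op Omega n E (A \<circ> Diag_op (fe_fun n E q) \<circ> A) = fe_fun n E (?H *\<^sub>v q)" .
qed simp

lemma has_matrix_rep_if_represents:
  assumes "represents_on_Vh n E A X"
  shows "has_matrix_rep Omega n E A X"
proof -
  let ?mu = "\<lambda>i. measure lebesgue (E i)"
  note X = represents_on_Vh_carrier[OF assms]
  have "?mu i \<noteq> 0" if "i < n" for i using element_measure_pos[OF that] by simp
  then have "minv (mass_mat n E) * gram Omega n E A = X"
    unfolding gram_of_represents[OF assms] mass_mat_def Diag_vec_eq_mat_diag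
    using X by (simp add: minv_mat_diag mat_diag_mult_left[of _ n n]) (auto intro!: eq_matI)
  then show ?thesis
    using assms by (auto simp: has_matrix_rep_def has_coeffs_def represents_on_Vh_def)
qed

text \<open>
  The root has matrix \<open>M\<^sup>-\<^sup>1 C\<close>, so \<open>A\<close> has matrix \<open>M\<^sup>-\<^sup>1 C M\<^sup>-\<^sup>1 C\<close>, whose inverse is read off.
\<close>
lemma prior_precision_represented:
  assumes A: "pos_def_op Omega n E A" and lin: "linear_Vh n E S"
    and SS: "\<And>f. f \<in> Vh n E \<Longrightarrow> S (S f) = A f"
  defines "C \<equiv> gram Omega n E S" and "M \<equiv> mass_mat n E"
  shows "det C \<noteq> 0" "represents_on_Vh n E (inv_op n E A) (minv C * M * minv C * M)"
proof -
  let ?mu = "\<lambda>i. measure lebesgue (E i)"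
  define Mi where "Mi = mat_diag n (\<lambda>i. 1 / ?mu i)"
  obtain X where X: "represents_on_Vh n E S X" using linear_Vh_represented[OF lin] .
  note Xc = represents_on_Vh_carrier[OF X]
  have M: "M = mat_diag n ?mu" by (simp add: M_def mass_mat_def Diag_vec_eq_mat_diag)
  have mu: "?mu i \<noteq> 0" if "i < n" for i using element_measure_pos[OF that] by simp
  have MMi: "M * Mi = 1\<^sub>m n" "Mi * M = 1\<^sub>m n" using mu by (auto simp: M Mi_def intro!: mat_diag_eq_one)
  have Mc: "M \<in> carrier_mat n n" "Mi \<in> carrier_mat n n" by (simp_all add: M Mi_def)
  have CX: "C = M * X"
    unfolding C_def gram_of_represents[OF X] M mat_diag_mult_left[OF Xc] by simp
  have Cc: "C \<in> carrier_mat n n" by (simp add: C_def gram_def)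
  have "det M \<noteq> 0" using det_mult[OF Mc] MMi by auto
  moreover have "det X \<noteq> 0" using pos_def_op_sqrt_matrix_nonsingular[OF A SS X] .
  ultimately show det: "det C \<noteq> 0" by (simp add: CX det_mult[OF Mc(1) Xc])
  note Ci = minv_right_left[OF Cc det]
  note [simp] = carrier_matD[OF Mc(1)] carrier_matD[OF Mc(2)] carrier_matD[OF Xc]
    carrier_matD[OF Cc] carrier_matD[OF Ci(1)]
  have XMi: "X = Mi * C" using mult_left_cancel[OF MMi(2), of X] by (simp add: CX)
  have "represents_on_Vh n E A (X * X)"
    using represents_on_Vh_comp[OF X X] SS by (simp add: represents_on_Vh_def)
  moreover have "X * X * (minv C * M * minv C * M) = 1\<^sub>m n"
    using mult_left_cancel[OF MMi(2)] mult_left_cancel[OF Ci(2)] MMi(2)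
    by (simp add: XMi mult_assoc_dim)
  ultimately show "represents_on_Vh n E (inv_op n E A) (minv C * M * minv C * M)"
    by (intro represents_on_Vh_inverse(2)[of A "X * X"] carrier_matI) simp_all
qed

end

section \<open>Posterior covariance and mean\<close>

theorem theorem3p5:
  fixes Omega :: "'d::euclidean_space set" and E :: "nat \<Rightarrow> 'd set"
    and n m l lh :: nat
    and Fop :: "('d \<Rightarrow> real) \<Rightarrow> real vec"
    and C0 C0half :: "('d \<Rightarrow> real) \<Rightarrow> ('d \<Rightarrow> real)"
    and q0 :: "'d \<Rightarrow> real" and q0vec w :: "real vec"
    and \<Gamma> G F C M Q R Qh Rh Lw Lhw Cpost :: "real mat"
  assumes mesh: "is_mesh Omega n E"
    and fwd: "linear_Vh_vec n E m Fop"
    and noise: "\<Gamma> \<in> carrier_mat m m" "diagonal_mat \<Gamma>" "pos_def_mat m \<Gamma>"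
    and prior_cov: "self_adjoint Omega n E C0" "pos_def_op Omega n E C0"
    and prior_sqrt: "is_sqrt_op Omega n E C0 C0half"
    and prior_mean: "has_coeffs n E q0 q0vec"
    and M: "M = mass_mat n E"
    and F: "F = matrix_of_fwd n E m Fop"
    and C: "C = gram Omega n E C0half"
    and design: "w \<in> carrier_vec m" "\<forall>i<m. 0 \<le> w $ i \<and> w $ i \<le> 1"
    and QR: "thin_QR l (inv_sqrt_diag M * transpose_mat F * inv_sqrt_diag \<Gamma>) Q R"
    and QRh: "thin_QR lh (inv_sqrt_diag M * C * minv M *
                transpose_mat (khatri_rao (transpose_mat Q) (transpose_mat Q))) Qh Rh"
    and Lw: "Lw = R * Diag w * transpose_mat R"
    and Lhw: "Lhw = Rh * kronecker Lw Lw * transpose_mat Rh"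
    and Cpost: "Cpost = minv M * C * inv_sqrt_diag M *
                (1\<^sub>m n - Qh * transpose_mat Qh + Qh * minv (Lhw + 1\<^sub>m lh) * transpose_mat Qh) *
                inv_sqrt_diag M * C"
    and data: "G \<in> carrier_mat m m"
  shows "bij_betw (post_precision Omega n E Fop \<Gamma> C0 w) (Vh n E) (Vh n E)
       \<and> invertible_mat (Lhw + 1\<^sub>m lh)
       \<and> has_matrix_rep Omega n E (post_cov Omega n E Fop \<Gamma> C0 w) Cpost
       \<and> has_coeffs n E (post_mean Omega n E Fop \<Gamma> C0 q0 G w)
           (Cpost *\<^sub>v
             (minv M *\<^sub>v diag (Q * R * inv_sqrt_diag \<Gamma> * Diag w * G * Diag w * inv_sqrt_diag \<Gamma> *
                               transpose_mat R * transpose_mat Q)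
              + (minv C * M * minv C * M) *\<^sub>v q0vec))"
proof -
  \<comment> \<open>The matrices \<open>Mi\<close>, \<open>D\<close>, \<open>H\<close> are the powers \<open>-1\<close>, \<open>-1/2\<close>, \<open>1/2\<close> of the mass matrix,
      \<open>g\<close> is the noise covariance to the power \<open>-1/2\<close>, and \<open>J\<close> is the weight between the
      Khatri-Rao factors \<open>K\<close> in the Hessian.\<close>
  define mu where "mu = (\<lambda>i. measure lebesgue (E i))"
  define gam where "gam = (\<lambda>i. \<Gamma> $$ (i, i))"
  define Mi where "Mi = mat_diag n (\<lambda>i. 1 / mu i)"
  define D where "D = mat_diag n (\<lambda>i. 1 / sqrt (mu i))"
  define H where "H = mat_diag n (\<lambda>i. sqrt (mu i))"
  define g where "g = inv_sqrt_diag \<Gamma>"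
  define W where "W = Diag w"
  define K where "K = khatri_rao (transpose_mat Q) (transpose_mat Q)"
  define J where "J = kronecker Lw Lw"
  have mu: "0 < mu i" if "i < n" for i using element_measure_pos[OF mesh that] by (simp add: mu_def)
  have mu': "mu i \<noteq> 0" "0 \<le> mu i" if "i < n" for i using mu[OF that] by auto
  have gam: "0 < gam i" if "i < m" for i
    using diagonal_pos_def_mat_diag(2)[OF noise(2,3) that] by (simp add: gam_def)
  have \<Gamma>: "\<Gamma> = mat_diag m gam" using diagonal_pos_def_mat_diag(1)[OF noise(2,3)] by (simp add: gam_def)
  have M': "M = mat_diag n mu" by (simp add: M mass_mat_def Diag_vec_eq_mat_diag mu_def)
  have Mi: "minv M = Mi" using mu' by (simp add: M' Mi_def minv_mat_diag)
  have D: "inv_sqrt_diag M = D" by (simp add: M' D_def inv_sqrt_diag_mat_diag)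
  have g: "g = mat_diag m (\<lambda>i. 1 / sqrt (gam i))" by (simp add: g_def \<Gamma> inv_sqrt_diag_mat_diag)
  have W: "W = mat_diag m (($) w)" using design(1) by (simp add: W_def Diag_def)
  have minv\<Gamma>: "minv \<Gamma> = g * g"
  proof -
    have "minv \<Gamma> = mat_diag m (\<lambda>i. 1 / gam i)" using gam by (simp add: \<Gamma> minv_mat_diag less_imp_neq[symmetric])
    also have "\<dots> = g * g" using gam by (simp add: g) (auto simp: mat_diag_def abs_of_pos intro!: eq_matI)
    finally show ?thesis .
  qed
  have Wg: "W * (g * g) = g * (g * W)" "g * W = W * g" by (simp_all add: W g mult_ac)
  have Fc: "F \<in> carrier_mat m n" by (simp add: F matrix_of_fwd_def)
  have QRc: "Q \<in> carrier_mat n l" "R \<in> carrier_mat l m" and QRe: "Q * R = D * transpose_mat F * g"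
    using QR unfolding thin_QR_def D g_def[symmetric] by (simp_all add: D_def g)
  have Kc: "K \<in> carrier_mat (l * l) n" using QRc by (intro carrier_matI) (auto simp: K_def)
  have Lc: "Lw \<in> carrier_mat l l" using QRc design(1) by (intro carrier_matI) (auto simp: Lw)
  have Jc: "J \<in> carrier_mat (l * l) (l * l)" using Lc by (intro carrier_matI) (auto simp: J_def)
  have QRhc: "Qh \<in> carrier_mat n lh" "Rh \<in> carrier_mat lh (l * l)" "transpose_mat Qh * Qh = 1\<^sub>m lh"
    and QRhe: "Qh * Rh = D * C * Mi * transpose_mat K"
    using QRh Kc by (simp_all add: thin_QR_def D Mi K_def[symmetric] D_def)
  have dims [simp]: "dim_row D = n" "dim_col D = n" "dim_row H = n" "dim_col H = n" "dim_row Mi = n" "dim_col Mi = n"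
    "dim_row g = m" "dim_col g = m" "dim_row W = m" "dim_col W = m" "dim_row G = m" "dim_col G = m"
    "dim_row F = m" "dim_col F = n" "dim_row Q = n" "dim_col Q = l" "dim_row R = l" "dim_col R = m"
    "dim_row Lw = l" "dim_col Lw = l"
    using Fc QRc data Lc by (simp_all add: D_def H_def Mi_def g W)
  have tr: "transpose_mat D = D" "transpose_mat g = g" "transpose_mat W = W" by (simp_all add: D_def g W_def)

  \<comment> \<open>Nonnegative weights make \<open>Lhw\<close> a Gram matrix, hence \<open>Lhw + 1\<close> nonsingular.\<close>
  obtain T where T: "T \<in> carrier_mat lh (m * m)" "Rh * kronecker Lw Lw * transpose_mat Rh = T * transpose_mat T"
    using gram_factor_of_weighted_kronecker[OF QRc(2) design(1) _ Lw QRhc(2)] design(2) by metis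
  have det: "det (Lhw + 1\<^sub>m lh) \<noteq> 0" using det_gram_plus_one[OF T(1)] by (simp add: Lhw T(2))
  have Lhc: "Lhw + 1\<^sub>m lh \<in> carrier_mat lh lh" using QRhc(2) by (intro carrier_matI) (auto simp: Lhw)
  note N = minv_right_left[OF Lhc det]

  have Ssa: "self_adjoint Omega n E C0half" and SS: "\<And>f. f \<in> Vh n E \<Longrightarrow> C0half (C0half f) = C0 f"
    using prior_sqrt by (simp_all add: is_sqrt_op_def)
  have Cc: "C \<in> carrier_mat n n" by (simp add: C gram_def)
  have Ct: "transpose_mat C = C" using gram_symmetric[OF mesh Ssa] by (simp add: C)
  note root = prior_precision_represented[OF mesh prior_cov(2) _ SS, folded C M]
  have detC: "det C \<noteq> 0" using root(1) Ssa by (simp add: self_adjoint_def)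
  define Pr where "Pr = minv C * M * minv C * M"
  have prior: "represents_on_Vh n E (inv_op n E C0) Pr"
    using root(2) Ssa by (simp add: self_adjoint_def Pr_def)
  note Ci = minv_right_left[OF Cc detC]
  have Mdim [simp]: "dim_row M = n" "dim_col M = n" "dim_row C = n" "dim_col C = n"
    "dim_row (minv C) = n" "dim_col (minv C) = n"
    using Cc Ci(1) by (simp_all add: M')
  have Prc: "Pr \<in> carrier_mat n n" by (intro carrier_matI) (simp_all add: Pr_def)

  have sq: "sqrt (mu i) / mu i = 1 / sqrt (mu i)" if "i < n" for i
    using mu[OF that] by (simp add: field_simps)
  have HD: "H * D = 1\<^sub>m n" "D * H = 1\<^sub>m n" and MiH: "Mi * H = D"
    using mu' by (auto simp: Mi_def D_def H_def intro!: mat_diag_eq_one)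
       (auto simp: mat_diag_def sq intro!: eq_matI)
  \<comment> \<open>Solving the first QR decomposition for the forward matrix removes it from every formula.\<close>
  have Ftg: "transpose_mat F * g = H * (Q * R)"
    using mult_left_cancel[OF HD(1)] by (simp add: QRe mult_assoc_dim)
  have gF: "g * F = transpose_mat R * (transpose_mat Q * H)"
  proof -
    have "g * F = transpose_mat (transpose_mat F * g)" by (simp add: transpose_mult_dim tr)
    also have "\<dots> = transpose_mat R * (transpose_mat Q * H)"
      unfolding Ftg by (simp add: transpose_mult_dim mult_assoc_dim) (simp add: H_def)
    finally show ?thesis .
  qed
  have Fop: "Fop (fe_fun n E v) = F *\<^sub>v v" if "v \<in> carrier_vec n" for v
    using linear_Vh_vec_fe_fun[OF fwd that] by (simp add: F)
  define P where "P = Q * Lw * transpose_mat Q"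
  define S where "S = D * P * H"
  have "Mi * transpose_mat F * weighted_noise_pinv \<Gamma> w * F = S"
  proof -
    have "Mi * transpose_mat F * weighted_noise_pinv \<Gamma> w * F = Mi * (transpose_mat F * g * (W * (g * F)))"
      by (simp add: weighted_noise_pinv_def mult_assoc_dim flip: g_def W_def)
    also have "\<dots> = Mi * H * (Q * (R * W * transpose_mat R) * transpose_mat Q) * H"
      unfolding Ftg gF by (simp add: mult_assoc_dim)
    finally show ?thesis by (simp add: MiH S_def P_def Lw W_def)
  qed
  moreover have "represents_on_Vh n E (misfit_op Omega n E Fop \<Gamma> w) (Mi * transpose_mat F * weighted_noise_pinv \<Gamma> w * F)"
    unfolding misfit_op_def Mi_def mu_def
    by (rule normal_operator_represented[OF mesh Fc Fop])
       (auto intro!: carrier_matI simp: weighted_noise_pinv_def simp flip: g_def W_def)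
  ultimately have misfit: "represents_on_Vh n E (misfit_op Omega n E Fop \<Gamma> w) S" by simp
  have Pt: "transpose_mat P = P"
    by (simp add: P_def Lw transpose_mult_dim mult_assoc_dim tr flip: W_def)
  have Pdim [simp]: "dim_row P = n" "dim_col P = n" by (simp_all add: P_def)
  have Pc: "P \<in> carrier_mat n n" by (intro carrier_matI) simp_all
  \<comment> \<open>The misfit matrix \<open>S\<close> is similar to the symmetric \<open>P\<close> by the diagonal \<open>D\<close>, so in the
      products \<open>S\<^sub>i\<^sub>j S\<^sub>j\<^sub>i\<close> the scaling cancels and \<open>P\<^sub>i\<^sub>j\<^sup>2\<close> remains.\<close>
  have Sij: "S $$ (i, j) = P $$ (i, j) * sqrt (mu j) / sqrt (mu i)" if "i < n" "j < n" for i j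
    unfolding S_def D_def H_def using that Pc
    by (simp add: mat_diag_mult_left[of _ n n] mat_diag_mult_right[of _ n n])
  have "mat n n (\<lambda>(i, j). S $$ (i, j) * S $$ (j, i) / measure lebesgue (E i)) = Mi * transpose_mat K * J * K"
  proof (rule eq_matI)
    fix i j assume "i < dim_row (Mi * transpose_mat K * J * K)" "j < dim_col (Mi * transpose_mat K * J * K)"
    then have ij: "i < n" "j < n" using Kc by simp_all
    have KJK: "transpose_mat K * J * K \<in> carrier_mat n n" using Kc by (intro carrier_matI) auto
    have "P $$ (j, i) = P $$ (i, j)" using ij Pt by (metis index_transpose_mat(1) Pdim)
    then have "S $$ (i, j) * S $$ (j, i) = (P $$ (i, j))\<^sup>2"
      using ij mu[OF ij(1)] mu[OF ij(2)] by (simp add: Sij power2_eq_square)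
    also have "\<dots> = (transpose_mat K * J * K) $$ (i, j)"
      using congruence_kronecker_square_index[OF QRc(1) Lc ij] by (simp add: K_def J_def P_def)
    also have "\<dots> / mu i = (Mi * (transpose_mat K * J * K)) $$ (i, j)"
      using ij by (simp add: Mi_def mat_diag_mult_left[OF KJK] del: index_mult_mat(1))
    finally show "mat n n (\<lambda>(i, j). S $$ (i, j) * S $$ (j, i) / measure lebesgue (E i)) $$ (i, j)
        = (Mi * transpose_mat K * J * K) $$ (i, j)"
      using ij Kc Jc by (simp add: mu_def mult_assoc_dim del: index_mult_mat(1))
  qed (use Kc in simp_all)
  then have hess: "represents_on_Vh n E (hessian_op Omega n E Fop \<Gamma> w) (Mi * transpose_mat K * J * K)"
    using diag_op_of_sandwich_represented[OF mesh misfit] by (simp add: hessian_op_def)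

  have prec: "represents_on_Vh n E (post_precision Omega n E Fop \<Gamma> C0 w) (Mi * transpose_mat K * J * K + Pr)"
    unfolding post_precision_def by (rule represents_on_Vh_add[OF hess prior])
  have Cpc: "Cpost \<in> carrier_mat n n" by (intro carrier_matI) (simp_all add: Cpost Mi)
  have "(Mi * transpose_mat K * J * K + Pr) * Cpost = 1\<^sub>m n"
    unfolding Cpost Mi D Pr_def
    using posterior_precision_times_covariance[OF mu Cc Ct detC Kc Jc QRhc(1,3,2) N(1)] N(2) QRhe
    by (simp add: Lhw J_def Mi_def D_def M')
  note inverse = represents_on_Vh_inverse[OF mesh prec Cpc this]
  have cov: "represents_on_Vh n E (post_cov Omega n E Fop \<Gamma> C0 w) Cpost"
    using inverse(2) by (simp add: post_cov_def)

  \<comment> \<open>For the mean, the diagonal matrices \<open>W\<close> and \<open>g\<close> commute; this moves one factor \<open>g\<close> of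
      \<open>minv \<Gamma> = g * g\<close> next to \<open>F\<close>, where it is absorbed in \<open>Q * R\<close>. What is left is
      similar to \<open>Z\<close> by a diagonal matrix and has the same diagonal.\<close>
  define Z where "Z = Q * R * g * W * G * W * g * transpose_mat R * transpose_mat Q"
  have Zc: "Z \<in> carrier_mat n n" by (intro carrier_matI) (simp_all add: Z_def)
  have WFop: "weighted_fwd w Fop (fe_fun n E v) = (W * F) *\<^sub>v v" if "v \<in> carrier_vec n" for v
    using that by (simp add: weighted_fwd_def Fop W_def[symmetric] mult_assoc_vec_dim)
  have "represents_on_Vh n E (\<lambda>f. L2_adjoint Omega n E (weighted_fwd w Fop)
      ((minv \<Gamma> * G * minv \<Gamma>) *\<^sub>v weighted_fwd w Fop f))
      (Mi * transpose_mat (W * F) * (minv \<Gamma> * G * minv \<Gamma>) * (W * F))"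
    unfolding Mi_def mu_def
    by (rule normal_operator_represented[OF mesh _ WFop]) (auto intro!: carrier_matI simp: minv\<Gamma>)
  also have "Mi * transpose_mat (W * F) * (minv \<Gamma> * G * minv \<Gamma>) * (W * F) = D * Z * H"
  proof -
    have "Mi * transpose_mat (W * F) * (minv \<Gamma> * G * minv \<Gamma>) * (W * F)
        = Mi * (transpose_mat F * (W * (g * g)) * (G * ((g * g) * W * F)))"
      by (simp add: transpose_mult_dim tr minv\<Gamma> mult_assoc_dim)
    also have "W * (g * g) = g * (g * W)" by (fact Wg(1))
    also have "g * g * W = W * g * g" using Wg by (simp add: mult_assoc_dim)
    also have "Mi * (transpose_mat F * (g * (g * W)) * (G * (W * g * g * F)))
        = Mi * (transpose_mat F * g * (g * (W * (G * (W * (g * (g * F)))))))"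
      by (simp add: mult_assoc_dim)
    also have "\<dots> = Mi * H * (Z * H)"
      unfolding Ftg gF by (simp add: Z_def mult_assoc_dim)
    finally show ?thesis by (simp only: MiH mult_assoc_dim[of D Z H] dims) (use Zc in \<open>simp add: mult_assoc_dim\<close>)
  qed
  finally have "represents_on_Vh n E (\<lambda>f. L2_adjoint Omega n E (weighted_fwd w Fop)
      ((minv \<Gamma> * G * minv \<Gamma>) *\<^sub>v weighted_fwd w Fop f)) (D * Z * H)" .
  note diag_op_of_represents[OF mesh this]
  also have "vec n (\<lambda>i. (D * Z * H) $$ (i, i) / measure lebesgue (E i)) = Mi *\<^sub>v diag Z"
  proof (rule eq_vecI)
    fix i assume "i < dim_vec (Mi *\<^sub>v diag Z)"
    then have i: "i < n" by simp
    have dZ: "diag Z \<in> carrier_vec n" using Zc by (intro carrier_vecI) (simp add: diag_def)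
    have "(D * Z * H) $$ (i, i) = Z $$ (i, i)"
      unfolding D_def H_def using i Zc mu[OF i]
      by (simp add: mat_diag_mult_left[of _ n n] mat_diag_mult_right[of _ n n])
    then show "vec n (\<lambda>i. (D * Z * H) $$ (i, i) / measure lebesgue (E i)) $ i = (Mi *\<^sub>v diag Z) $ i"
      unfolding Mi_def mat_diag_mult_vec[OF dZ] using i Zc by (simp add: mu_def diag_def)
  qed simp
  finally have data_term: "diag_op Omega n E (\<lambda>f. L2_adjoint Omega n E (weighted_fwd w Fop)
      ((minv \<Gamma> * G * minv \<Gamma>) *\<^sub>v weighted_fwd w Fop f)) = fe_fun n E (Mi *\<^sub>v diag Z)" .
  have q0: "q0vec \<in> carrier_vec n" "q0 = fe_fun n E q0vec"
    using prior_mean by (simp_all add: has_coeffs_def)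
  have c: "Mi *\<^sub>v diag Z \<in> carrier_vec n" "Pr *\<^sub>v q0vec \<in> carrier_vec n"
    using Prc by (auto intro!: carrier_vecI)
  have "post_mean Omega n E Fop \<Gamma> C0 q0 G w
      = post_cov Omega n E Fop \<Gamma> C0 w (fe_fun n E (Mi *\<^sub>v diag Z + Pr *\<^sub>v q0vec))"
    unfolding post_mean_def data_term q0(2) represents_on_Vh_apply[OF prior q0(1)] fe_fun_add[OF c] ..
  also have "\<dots> = fe_fun n E (Cpost *\<^sub>v (Mi *\<^sub>v diag Z + Pr *\<^sub>v q0vec))"
    using c by (intro represents_on_Vh_apply[OF cov]) simp
  finally have mean: "has_coeffs n E (post_mean Omega n E Fop \<Gamma> C0 q0 G w)
      (Cpost *\<^sub>v (Mi *\<^sub>v diag Z + Pr *\<^sub>v q0vec))"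
    using Cpc by (auto simp: has_coeffs_def intro!: carrier_vecI)
  show ?thesis
    using inverse(1) invertible_matI_det[OF Lhc det] has_matrix_rep_if_represents[OF mesh cov] mean
    by (simp add: Mi Z_def Pr_def g_def W_def)
qed

end
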